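(* Let $n\ge 1$, let $f:\mathbb{R}^n\to[0,\infty)$ be an integrable log-concave function with $\int_{\mathbb{R}^n} f(x)\,dx>0$, let $$L=\{(x,t)\in\mathbb{R}^{n+1}\,:\, x\in\mathbb{R}^n,\ t\in\mathbb{R},\ f(x)\ge e^{-t}\Vert f\Vert_\infty\},$$ and let $h:L\to[0,\infty)$ be a concave function. Then the function $$p\mapsto \left(\frac{1}{\Gamma(1+p)\int_L e^{-t}\,dt\,dx}\int_L h^p(x,t)\,e^{-t}\,dt\,dx\right)^{\frac1p}$$ is decreasing in $p\in(-1,\infty)$.
   Context: A function $f:\mathbb{R}^n\to[0,\infty)$ is log-concave if $f(\lambda x+(1-\lambda)y)\ge f(x)^{\lambda}f(y)^{1-\lambda}$ for all $x,y\in\mathbb{R}^n$ and $0<\lambda<1$. $\Vert f\Vert_\infty=\sup_{x\in\mathbb{R}^n} f(x)$, which is finite and positive for an integrable log-concave $f$ with positive integral. The set $L$ is the epigraph of the convex function $-\log\frac{f}{\Vert f\Vert_\infty}$; it is convex and contained in $\{t\ge 0\}$. Integrals are with respect to Lebesgue measure on $\mathbb{R}^{n+1}$, and $\Gamma$ is the Gamma function. At $p=0$ the expression is understood as its limit as $p\to0$. "Decreasing" is meant in the non-strict sense (non-increasing). For $p<0$ the usual conventions $0^p=+\infty$ and $(+\infty)^{1/p}=0$ are used. *)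

theory Defs
  imports "HOL-Analysis.Analysis"
begin

definition log_concave :: "('a::real_vector \<Rightarrow> real) \<Rightarrow> bool" where
  "log_concave f \<longleftrightarrow>
     (\<forall>x. 0 \<le> f x) \<and>
     (\<forall>x y l. 0 < l \<and> l < 1 \<longrightarrow>
        f (l *\<^sub>R x + (1 - l) *\<^sub>R y) \<ge> f x powr l * f y powr (1 - l))"

(* The real-valued supremum is the sup norm only for f nonnegative and bounded above;
   integrable log-concave f with positive integral is bounded. *)
definition sup_norm :: "('a \<Rightarrow> real) \<Rightarrow> real" where
  "sup_norm f = (SUP x. f x)"

definition epi_L :: "('a \<Rightarrow> real) \<Rightarrow> ('a \<times> real) set" where
  "epi_L f = {(x, t). f x \<ge> exp (- t) * sup_norm f}"

(* Real powers on [0, \<infinity>] with 0^a = \<infinity> and \<infinity>^a = 0 for a < 0. Needed because real powr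
   has 0 powr a = 0 for every a. *)
definition epowr :: "ennreal \<Rightarrow> real \<Rightarrow> ennreal" where
  "epowr x a =
     (if a = 0 then 1
      else if x = 0 then (if a < 0 then \<infinity> else 0)
      else if x = \<infinity> then (if a < 0 then 0 else \<infinity>)
      else ennreal (enn2real x powr a))"

(* Only meaningful for p \<noteq> 0: at p = 0 the outer exponent 1 / p is the junk value 0. *)
definition berwald_mean ::
  "('a::euclidean_space \<Rightarrow> real) \<Rightarrow> ('a \<times> real \<Rightarrow> real) \<Rightarrow> real \<Rightarrow> ennreal" where
  "berwald_mean f h p =
     epowr
       ((\<integral>\<^sup>+ z \<in> epi_L f. (epowr (ennreal (h z)) p * ennreal (exp (- snd z))) \<partial>lebesgue) /
        (ennreal (Gamma (1 + p)) * (\<integral>\<^sup>+ z \<in> epi_L f. ennreal (exp (- snd z)) \<partial>lebesgue)))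
       (1 / p)"

end

theory Submission
  imports Defs "HOL-Probability.Probability"
begin

text \<open>Let \<open>U\<close> be the interior of \<open>L\<close> and \<open>P\<close> the probability measure on \<open>U\<close> with density proportional
  to \<open>exp (- t)\<close>. Since \<open>h\<close> is concave and the density is log-concave, the Prekopa-Leindler inequality
  gives \<open>\<phi> (l * s) \<ge> \<phi> s powr l\<close> for the tail \<open>\<phi> s = P (s < h)\<close> and \<open>0 < l < 1\<close>. Hence \<open>\<phi>\<close>
  crosses each exponential tail \<open>exp (- s / c)\<close> at most once, from above. An exponential variable with
  mean \<open>c\<close> has \<open>p\<close>-th moment \<open>c powr p * Gamma (1 + p)\<close>, so writing moments as integrals of
  tails against powers turns the single crossing into the implication
  \<open>m p < c \<Longrightarrow> m q \<le> c\<close> for the normalised means \<open>m\<close> and \<open>p < q\<close>. The limit at 0 exists because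
  \<open>p \<mapsto> E (h powr p)\<close> is differentiable there. If \<open>h\<close> vanishes somewhere on \<open>U\<close>, it vanishes on \<open>U\<close>
  and all means are 0.\<close>

subsection \<open>The Prekopa-Leindler inequality\<close>

text \<open>Exponential variables are the right yardstick because their normalised mean is the same
  \<open>c\<close> for every exponent. The obstacle is that exponents of both signs must be
  compared, even a negative \<open>p\<close> with a positive \<open>q\<close>. For
  \<open>p < 0\<close> the weight \<open>s powr (p - 1)\<close> is not integrable at 0, so the
  moment is an integral of \<open>P (h \<le> s)\<close> instead of the tail. However, the difference
  of two moments divided by \<open>p\<close> is, for either sign, the integral of
  \<open>s powr (p - 1)\<close> times the difference of the tails. Likewise
  \<open>m p \<le> c\<close> means
  \<open>(E (h powr p) - c powr p * Gamma (1 + p)) / p \<le> 0\<close> for either sign, so one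
  crossing argument covers all cases. The bound \<open>p > -1\<close> comes from the behaviour at 0:
  the inequality for \<open>\<phi>\<close> yields \<open>\<phi> s \<ge> exp (- s / c)\<close> for
  small \<open>s\<close> and some \<open>c\<close>, so \<open>P (h \<le> s)\<close> is at most of
  order \<open>s\<close>, and \<open>s powr (p - 1) * s\<close> is integrable at 0 exactly when
  \<open>p > -1\<close>.\<close>

lemma emeasure_lborel_add_vimage:
  fixes A :: "real set"
  assumes [measurable]: "A \<in> sets borel"
  shows "emeasure lborel ((\<lambda>x. x - c) -` A) = emeasure lborel A"
proof -
  have m: "(\<lambda>x. x - c) -` A \<in> sets borel"
    using measurable_sets[of "\<lambda>x. x - c" borel borel A] by simp
  have "(\<lambda>x. indicator A (- c + 1 * x)) = (indicator ((\<lambda>x. x - c) -` A) :: real \<Rightarrow> ennreal)"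
    by (auto simp: indicator_def)
  thus ?thesis
    using nn_integral_real_affine[of "indicator A" 1 "-c"] m by simp
qed

lemma emeasure_lborel_scale_vimage:
  fixes A :: "real set"
  assumes [measurable]: "A \<in> sets borel" and c: "c > 0"
  shows "emeasure lborel ((\<lambda>x. x / c) -` A) = ennreal c * emeasure lborel A"
proof -
  have m: "(\<lambda>x. x / c) -` A \<in> sets borel"
    using measurable_sets[of "\<lambda>x. x / c" borel borel A] by simp
  have "(\<lambda>x. indicator A (0 + inverse c * x)) = (indicator ((\<lambda>x. x / c) -` A) :: real \<Rightarrow> ennreal)"
    by (auto simp: indicator_def field_simps)
  hence "emeasure lborel A = ennreal (inverse c) * emeasure lborel ((\<lambda>x. x / c) -` A)"
    using nn_integral_real_affine[of "indicator A" "inverse c" 0] m c by simp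
  thus ?thesis using c by (simp add: mult.assoc[symmetric] ennreal_mult[symmetric])
qed

text \<open>Translates of \<open>A\<close> and \<open>B\<close> by near-extremal points lie in \<open>C\<close> and overlap only in a short
  interval.\<close>

lemma brunn_minkowski_real_bounded:
  fixes A B C :: "real set"
  assumes [measurable]: "A \<in> sets borel" "B \<in> sets borel" "C \<in> sets borel"
    and ne: "A \<noteq> {}" "B \<noteq> {}" and bdd: "bdd_above A" "bdd_below B"
    and sub: "\<And>a b. a \<in> A \<Longrightarrow> b \<in> B \<Longrightarrow> a + b \<in> C"
  shows "emeasure lborel A + emeasure lborel B \<le> emeasure lborel C"
proof (rule ennreal_le_epsilon)
  fix e :: real assume e: "e > 0"
  obtain a where a: "a \<in> A" "a > Sup A - e / 2"
    using less_cSupD[of A "Sup A - e/2"] ne e by auto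
  obtain b where b: "b \<in> B" "b < Inf B + e / 2"
    using cInf_lessD[of B "Inf B + e/2"] ne e by auto
  define A' where "A' = (\<lambda>x. x - b) -` A"
  define B' where "B' = (\<lambda>x. x - a) -` B"
  have [measurable]: "A' \<in> sets borel" "B' \<in> sets borel"
    using measurable_sets[of "\<lambda>x. x - b" borel borel A] measurable_sets[of "\<lambda>x. x - a" borel borel B]
    by (simp_all add: A'_def B'_def)
  have int: "A' \<inter> B' \<subseteq> {a + Inf B .. Sup A + b}"
  proof
    fix x assume "x \<in> A' \<inter> B'"
    hence "x - b \<le> Sup A" "Inf B \<le> x - a"
      using bdd by (auto simp: A'_def B'_def intro: cSup_upper cInf_lower)
    thus "x \<in> {a + Inf B .. Sup A + b}" by simp
  qed
  have un: "A' \<union> B' \<subseteq> C"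
  proof
    fix x assume "x \<in> A' \<union> B'"
    thus "x \<in> C" using sub[of "x - b" b] sub[of a "x - a"] a b by (auto simp: A'_def B'_def)
  qed
  have "emeasure lborel A + emeasure lborel B = emeasure lborel A' + emeasure lborel B'"
    by (simp add: A'_def B'_def emeasure_lborel_add_vimage)
  also have "\<dots> = emeasure lborel (A' \<union> B') + emeasure lborel (A' \<inter> B')"
    by (rule emeasure_Un_Int) auto
  also have "\<dots> \<le> emeasure lborel C + emeasure lborel {a + Inf B .. Sup A + b}"
    by (intro add_mono emeasure_mono int un) auto
  also have "emeasure lborel {a + Inf B .. Sup A + b} \<le> ennreal e"
    using a b e by (cases "a + Inf B \<le> Sup A + b") (auto intro!: ennreal_leI)
  finally show "emeasure lborel A + emeasure lborel B \<le> emeasure lborel C + ennreal e"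
    by (simp add: add_left_mono)
qed

lemma brunn_minkowski_real:
  fixes A B C :: "real set"
  assumes [measurable]: "A \<in> sets borel" "B \<in> sets borel" "C \<in> sets borel"
    and ne: "A \<noteq> {}" "B \<noteq> {}"
    and sub: "\<And>a b. a \<in> A \<Longrightarrow> b \<in> B \<Longrightarrow> a + b \<in> C"
  shows "emeasure lborel A + emeasure lborel B \<le> emeasure lborel C"
proof -
  obtain a b where ab: "a \<in> A" "b \<in> B" using ne by auto
  \<comment> \<open>With this \<open>K\<close> the points \<open>a\<close> and \<open>b\<close>
    survive every truncation, so the truncated sets are nonempty. One-sided cuts suffice because the
    bounded case asks only for an upper bound of \<open>A\<close> and a lower bound of
    \<open>B\<close>.\<close>
  define K where "K = \<bar>a\<bar> + \<bar>b\<bar>"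
  define A' where "A' n = A \<inter> {..K + real n}" for n :: nat
  define B' where "B' n = B \<inter> {-K - real n..}" for n :: nat
  have [measurable]: "A' n \<in> sets borel" "B' n \<in> sets borel" for n
    by (auto simp: A'_def B'_def)
  have le: "emeasure lborel (A' n) + emeasure lborel (B' n) \<le> emeasure lborel C" for n
  proof (rule brunn_minkowski_real_bounded)
    have "a \<in> A' n" "b \<in> B' n" using ab by (auto simp: A'_def B'_def K_def)
    thus "A' n \<noteq> {}" "B' n \<noteq> {}" by auto
    show "bdd_above (A' n)" "bdd_below (B' n)" by (auto simp: A'_def B'_def)
  qed (use sub in \<open>auto simp: A'_def B'_def\<close>)
  have "incseq A'" "incseq B'" by (auto simp: A'_def B'_def incseq_def)
  hence "(\<lambda>n. emeasure lborel (A' n)) \<longlonglongrightarrow> emeasure lborel (\<Union>n. A' n)"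
    "(\<lambda>n. emeasure lborel (B' n)) \<longlonglongrightarrow> emeasure lborel (\<Union>n. B' n)"
    by (auto intro!: Lim_emeasure_incseq)
  moreover have "(\<Union>n. A' n) = A"
  proof -
    have "\<exists>n. x \<le> K + real n" for x using real_arch_simple[of "x - K"] by (auto simp: algebra_simps)
    thus ?thesis by (auto simp: A'_def)
  qed
  moreover have "(\<Union>n. B' n) = B"
  proof -
    have "\<exists>n. -K - real n \<le> x" for x
    proof -
      obtain n where "- K - x \<le> real n" using real_arch_simple by blast
      thus ?thesis by (intro exI[of _ n]) linarith
    qed
    thus ?thesis by (auto simp: B'_def)
  qed
  ultimately have "(\<lambda>n. emeasure lborel (A' n) + emeasure lborel (B' n))
      \<longlonglongrightarrow> emeasure lborel A + emeasure lborel B"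
    by (intro tendsto_add) auto
  thus ?thesis by (rule LIMSEQ_le_const2) (use le in auto)
qed

lemma brunn_minkowski_real_convex_combination:
  fixes A B C :: "real set"
  assumes [measurable]: "A \<in> sets borel" "B \<in> sets borel" "C \<in> sets borel"
    and ne: "A \<noteq> {}" "B \<noteq> {}" and l: "0 < l" "l < 1"
    and sub: "\<And>a b. a \<in> A \<Longrightarrow> b \<in> B \<Longrightarrow> l * a + (1 - l) * b \<in> C"
  shows "ennreal l * emeasure lborel A + ennreal (1 - l) * emeasure lborel B \<le> emeasure lborel C"
proof -
  have "emeasure lborel ((\<lambda>x. x / l) -` A) + emeasure lborel ((\<lambda>x. x / (1 - l)) -` B)
      \<le> emeasure lborel C"
  proof (rule brunn_minkowski_real)
    show "(\<lambda>x. x / l) -` A \<in> sets borel" "(\<lambda>x. x / (1 - l)) -` B \<in> sets borel"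
      using measurable_sets[of "\<lambda>x. x / l" borel borel A]
        measurable_sets[of "\<lambda>x. x / (1 - l)" borel borel B] by simp_all
    obtain a b where ab: "a \<in> A" "b \<in> B" using ne by auto
    have "a * l \<in> (\<lambda>x. x / l) -` A" "b * (1 - l) \<in> (\<lambda>x. x / (1 - l)) -` B"
      using ab l by auto
    thus "(\<lambda>x. x / l) -` A \<noteq> {}" "(\<lambda>x. x / (1 - l)) -` B \<noteq> {}" by blast+
    fix x y assume "x \<in> (\<lambda>x. x / l) -` A" "y \<in> (\<lambda>x. x / (1 - l)) -` B"
    thus "x + y \<in> C" using sub[of "x / l" "y / (1 - l)"] l by simp
  qed auto
  thus ?thesis using l by (simp add: emeasure_lborel_scale_vimage)
qed

section \<open>Prekopa-Leindler on the real line, level by level\<close>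

lemma nn_integral_layer_cake:
  fixes u :: "'a \<Rightarrow> ennreal"
  assumes "sigma_finite_measure M" and [measurable]: "u \<in> borel_measurable M"
  shows "(\<integral>\<^sup>+x. u x \<partial>M) = (\<integral>\<^sup>+t. indicator {0<..} t * emeasure M {x \<in> space M. ennreal t < u x} \<partial>lborel)"
proof -
  interpret M: sigma_finite_measure M by fact
  interpret P: pair_sigma_finite lborel M ..
  have lev: "u x = (\<integral>\<^sup>+t. indicator {0<..} t * indicator {y. ennreal t < u y} x \<partial>lborel)" (is "_ = ?r") for x
  proof (cases "u x")
    case (real r)
    have "?r = (\<integral>\<^sup>+t. indicator {0<..<r} t \<partial>lborel)"
      using real by (intro nn_integral_cong) (auto simp: indicator_def ennreal_less_iff)
    thus ?thesis using real by simp
  next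
    case top
    have "?r = (\<integral>\<^sup>+t. indicator {0<..} (t::real) \<partial>lborel)"
      using top by (intro nn_integral_cong) (auto simp: indicator_def)
    also have "\<dots> = \<infinity>"
    proof (rule ccontr)
      assume "(\<integral>\<^sup>+t. indicator {0<..} (t::real) \<partial>lborel) \<noteq> \<infinity>"
      then obtain r where r: "emeasure lborel {0::real<..} = ennreal r" "r \<ge> 0"
        by (cases "emeasure lborel {0::real<..}") auto
      have "emeasure lborel {0<..r + 1} \<le> emeasure lborel {0::real<..}"
        by (rule emeasure_mono) auto
      thus False using r by simp
    qed
    finally show ?thesis using top by simp
  qed
  have "(\<integral>\<^sup>+x. u x \<partial>M) = (\<integral>\<^sup>+x. \<integral>\<^sup>+t. indicator {0<..} t * indicator {y. ennreal t < u y} x \<partial>lborel \<partial>M)"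
    by (intro nn_integral_cong lev)
  also have "\<dots> = (\<integral>\<^sup>+t. \<integral>\<^sup>+x. indicator {0<..} t * indicator {y. ennreal t < u y} x \<partial>M \<partial>lborel)"
    by (rule P.Fubini') simp
  also have "\<dots> = (\<integral>\<^sup>+t. indicator {0<..} t * emeasure M {x \<in> space M. ennreal t < u x} \<partial>lborel)"
  proof (intro nn_integral_cong)
    fix t :: real
    have "(\<integral>\<^sup>+x. indicator {0<..} t * indicator {y. ennreal t < u y} x \<partial>M)
       = indicator {0<..} t * (\<integral>\<^sup>+x. indicator {y \<in> space M. ennreal t < u y} x \<partial>M)"
      by (subst nn_integral_cmult[symmetric]) (auto intro!: nn_integral_cong simp: indicator_def)
    also have "\<dots> = indicator {0<..} t * emeasure M {x \<in> space M. ennreal t < u x}"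
      by (subst nn_integral_indicator) auto
    finally show "(\<integral>\<^sup>+x. indicator {0<..} t * indicator {y. ennreal t < u y} x \<partial>M) = \<dots>" .
  qed
  finally show ?thesis .
qed

text \<open>Brunn-Minkowski needs both sets nonempty. Supremum 1 for both functions makes their
  superlevel sets nonempty at exactly the same levels \<open>t < 1\<close>, so it applies at each of
  them. Integrating over the levels gives even the arithmetic mean on the left.\<close>

lemma prekopa_leindler_real_normalised:
  fixes f g :: "real \<Rightarrow> real" and h :: "real \<Rightarrow> ennreal"
  assumes [measurable]: "f \<in> borel_measurable borel" "g \<in> borel_measurable borel"
      "h \<in> borel_measurable borel"
    and f: "\<And>x. 0 \<le> f x" "\<And>x. f x \<le> 1" "\<And>t. t < 1 \<Longrightarrow> \<exists>x. t < f x"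
    and g: "\<And>x. 0 \<le> g x" "\<And>x. g x \<le> 1" "\<And>t. t < 1 \<Longrightarrow> \<exists>x. t < g x"
    and l: "0 < l" "l < 1"
    and le: "\<And>x y. ennreal (f x powr l * g y powr (1 - l)) \<le> h (l * x + (1 - l) * y)"
  shows "ennreal l * (\<integral>\<^sup>+x. f x \<partial>lborel) + ennreal (1 - l) * (\<integral>\<^sup>+x. g x \<partial>lborel) \<le> (\<integral>\<^sup>+x. h x \<partial>lborel)"
proof -
  have sf: "sigma_finite_measure (lborel :: real measure)" ..
  let ?I = "\<lambda>u t. indicator {0<..} t * emeasure lborel {x \<in> space lborel. ennreal t < u x}"
  have "ennreal l * (\<integral>\<^sup>+x. f x \<partial>lborel) + ennreal (1 - l) * (\<integral>\<^sup>+x. g x \<partial>lborel)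
     = ennreal l * (\<integral>\<^sup>+t. ?I f t \<partial>lborel) + ennreal (1 - l) * (\<integral>\<^sup>+t. ?I g t \<partial>lborel)"
    using nn_integral_layer_cake[OF sf, of "\<lambda>x. ennreal (f x)"]
      nn_integral_layer_cake[OF sf, of "\<lambda>x. ennreal (g x)"] by simp
  also have "\<dots> = (\<integral>\<^sup>+t. ennreal l * ?I f t + ennreal (1 - l) * ?I g t \<partial>lborel)"
    by (subst (1 2) nn_integral_cmult[symmetric], measurable) (simp add: nn_integral_add)
  also have "\<dots> \<le> (\<integral>\<^sup>+t. ?I h t \<partial>lborel)"
  proof (intro nn_integral_mono)
    fix t :: real
    consider "t \<le> 0" | "0 < t" "t < 1" | "1 \<le> t" by linarith
    thus "ennreal l * ?I f t + ennreal (1 - l) * ?I g t \<le> ?I h t"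
    proof cases
      case 2
      have "ennreal l * emeasure lborel {x. t < f x} + ennreal (1 - l) * emeasure lborel {x. t < g x}
          \<le> emeasure lborel {x. ennreal t < h x}"
      proof (rule brunn_minkowski_real_convex_combination)
        fix x y assume "x \<in> {x. t < f x}" "y \<in> {x. t < g x}"
        hence "t powr l * t powr (1 - l) < f x powr l * g y powr (1 - l)"
          using 2 l by (intro mult_strict_mono powr_less_mono2) auto
        hence "ennreal t < ennreal (f x powr l * g y powr (1 - l))"
          using 2 by (auto simp: powr_add[symmetric] ennreal_less_iff)
        also have "\<dots> \<le> h (l * x + (1 - l) * y)" by (rule le)
        finally show "l * x + (1 - l) * y \<in> {x. ennreal t < h x}" by simp
      qed (use 2 f(3) g(3) l in auto)
      thus ?thesis using 2 by (simp add: ennreal_less_iff)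
    next
      case 3
      have *: "{x. ennreal t < ennreal (f x)} = {}" "{x. ennreal t < ennreal (g x)} = {}"
        using 3 f(2) g(2) by (auto simp: ennreal_less_iff not_less intro: order_trans)
      show ?thesis using 3 by (simp add: *)
    qed simp
  qed
  also have "\<dots> = (\<integral>\<^sup>+x. h x \<partial>lborel)"
    by (rule nn_integral_layer_cake[OF sf, symmetric]) simp
  finally show ?thesis .
qed

lemma nn_integral_scale_enn2real:
  assumes "f \<in> borel_measurable M" "a > 0" "\<And>x. 0 \<le> f x" "(\<integral>\<^sup>+x. ennreal (f x) \<partial>M) < \<infinity>"
  shows "(\<integral>\<^sup>+x. ennreal (f x / a) \<partial>M) = ennreal (enn2real (\<integral>\<^sup>+x. ennreal (f x) \<partial>M) / a)"
proof -
  have "(\<integral>\<^sup>+x. ennreal (f x / a) \<partial>M) = (\<integral>\<^sup>+x. ennreal (1 / a) * ennreal (f x) \<partial>M)"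
    using assms by (intro nn_integral_cong) (simp add: ennreal_mult[symmetric])
  also have "\<dots> = ennreal (1 / a) * (\<integral>\<^sup>+x. ennreal (f x) \<partial>M)"
    using assms by (subst nn_integral_cmult) auto
  also have "\<dots> = ennreal (1 / a) * ennreal (enn2real (\<integral>\<^sup>+x. ennreal (f x) \<partial>M))"
    using assms(4) by (simp add: less_top[symmetric])
  also have "\<dots> = ennreal (enn2real (\<integral>\<^sup>+x. ennreal (f x) \<partial>M) / a)"
    using assms(2) by (simp add: ennreal_mult[symmetric])
  finally show ?thesis .
qed

text \<open>Division by the suprema \<open>a\<close> and \<open>b\<close> leads to the normalised
  case, with \<open>h\<close> divided by \<open>k = a powr l * b powr (1 - l)\<close>. The weighted
  AM-GM inequality then passes from the arithmetic to the geometric mean of \<open>F / a\<close> and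
  \<open>G / b\<close>, in which \<open>k\<close> cancels.\<close>

lemma prekopa_leindler_real_bounded:
  fixes f g :: "real \<Rightarrow> real" and h :: "real \<Rightarrow> ennreal"
  assumes [measurable]: "f \<in> borel_measurable borel" "g \<in> borel_measurable borel"
      "h \<in> borel_measurable borel"
    and f: "\<And>x. 0 \<le> f x" "\<And>x. f x \<le> K" "(\<integral>\<^sup>+x. f x \<partial>lborel) < \<infinity>"
    and g: "\<And>x. 0 \<le> g x" "\<And>x. g x \<le> K" "(\<integral>\<^sup>+x. g x \<partial>lborel) < \<infinity>"
    and l: "0 < l" "l < 1"
    and le: "\<And>x y. ennreal (f x powr l * g y powr (1 - l)) \<le> h (l * x + (1 - l) * y)"
  shows "ennreal (enn2real (\<integral>\<^sup>+x. f x \<partial>lborel) powr l * enn2real (\<integral>\<^sup>+x. g x \<partial>lborel) powr (1 - l))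
           \<le> (\<integral>\<^sup>+x. h x \<partial>lborel)"
proof -
  define F where "F = enn2real (\<integral>\<^sup>+x. f x \<partial>lborel)"
  define G where "G = enn2real (\<integral>\<^sup>+x. g x \<partial>lborel)"
  have nn: "F \<ge> 0" "G \<ge> 0" by (auto simp: F_def G_def)
  consider "F = 0 \<or> G = 0" | "F > 0" "G > 0" using nn by linarith
  hence "ennreal (F powr l * G powr (1 - l)) \<le> (\<integral>\<^sup>+x. h x \<partial>lborel)"
  proof cases
    case 2
    have bdd: "bdd_above (range f)" "bdd_above (range g)"
      using f(2) g(2) by (auto intro!: bdd_aboveI[of _ K])
    define a where "a = (SUP x. f x)"
    define b where "b = (SUP x. g x)"
    have fa: "f x \<le> a" and gb: "g x \<le> b" for x
      using bdd by (auto simp: a_def b_def intro: cSUP_upper)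
    have "\<exists>x. f x > 0"
    proof (rule ccontr)
      assume "\<nexists>x. f x > 0"
      hence "f x = 0" for x using f(1)[of x] by (meson not_less order_antisym)
      thus False using 2 by (simp add: F_def)
    qed
    hence a: "a > 0" using fa by (meson less_le_trans)
    have "\<exists>x. g x > 0"
    proof (rule ccontr)
      assume "\<nexists>x. g x > 0"
      hence "g x = 0" for x using g(1)[of x] by (meson not_less order_antisym)
      thus False using 2 by (simp add: G_def)
    qed
    hence b: "b > 0" using gb by (meson less_le_trans)
    define k where "k = a powr l * b powr (1 - l)"
    have k: "k > 0" using a b by (simp add: k_def)
    have "ennreal l * (\<integral>\<^sup>+x. f x / a \<partial>lborel) + ennreal (1 - l) * (\<integral>\<^sup>+x. g x / b \<partial>lborel)
       \<le> (\<integral>\<^sup>+x. ennreal (1 / k) * h x \<partial>lborel)"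
    proof (rule prekopa_leindler_real_normalised)
      show "\<exists>x. t < f x / a" if "t < 1" for t
      proof -
        have "t * a < a" using that a by simp
        hence "\<exists>x. t * a < f x"
          using less_cSUP_iff[of UNIV f "t * a"] bdd by (simp add: a_def[symmetric])
        thus ?thesis using a by (auto simp: field_simps)
      qed
      show "\<exists>x. t < g x / b" if "t < 1" for t
      proof -
        have "t * b < b" using that b by simp
        hence "\<exists>x. t * b < g x"
          using less_cSUP_iff[of UNIV g "t * b"] bdd by (simp add: b_def[symmetric])
        thus ?thesis using b by (auto simp: field_simps)
      qed
      fix x y
      have "ennreal ((f x / a) powr l * (g y / b) powr (1 - l))
          = ennreal (1 / k) * ennreal (f x powr l * g y powr (1 - l))"
        using a b f(1) g(1) by (simp add: powr_divide k_def ennreal_mult[symmetric])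
      also have "\<dots> \<le> ennreal (1 / k) * h (l * x + (1 - l) * y)"
        by (intro mult_left_mono le) auto
      finally show "ennreal ((f x / a) powr l * (g y / b) powr (1 - l)) \<le> \<dots>" .
    qed (use a b fa gb f(1) g(1) l in auto)
    also have "(\<integral>\<^sup>+x. f x / a \<partial>lborel) = ennreal (F / a)"
      unfolding F_def using a f by (intro nn_integral_scale_enn2real) auto
    also have "(\<integral>\<^sup>+x. g x / b \<partial>lborel) = ennreal (G / b)"
      unfolding G_def using b g by (intro nn_integral_scale_enn2real) auto
    also have "(\<integral>\<^sup>+x. ennreal (1 / k) * h x \<partial>lborel) = ennreal (1 / k) * (\<integral>\<^sup>+x. h x \<partial>lborel)"
      by (rule nn_integral_cmult) simp
    finally have "ennreal (l * (F / a) + (1 - l) * (G / b)) \<le> ennreal (1 / k) * (\<integral>\<^sup>+x. h x \<partial>lborel)"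
      using l a b nn by (simp add: ennreal_mult[symmetric] ennreal_plus[symmetric] del: ennreal_plus)
    hence "ennreal k * ennreal (l * (F / a) + (1 - l) * (G / b))
        \<le> ennreal k * (ennreal (1 / k) * (\<integral>\<^sup>+x. h x \<partial>lborel))"
      by (rule mult_left_mono) simp
    also have "\<dots> = (\<integral>\<^sup>+x. h x \<partial>lborel)"
      using k by (simp add: mult.assoc[symmetric] ennreal_mult[symmetric])
    finally have *: "ennreal (k * (l * (F / a) + (1 - l) * (G / b))) \<le> (\<integral>\<^sup>+x. h x \<partial>lborel)"
      using k l a b nn by (subst ennreal_mult) auto
    have "(F / a) powr l * (G / b) powr (1 - l) \<le> l * (F / a) + (1 - l) * (G / b)"
      using 2 a b l by (intro Youngs_inequality_0) auto
    hence "k * ((F / a) powr l * (G / b) powr (1 - l)) \<le> k * (l * (F / a) + (1 - l) * (G / b))"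
      using k by simp
    also have "k * ((F / a) powr l * (G / b) powr (1 - l)) = F powr l * G powr (1 - l)"
      using 2 a b by (simp add: k_def powr_divide)
    finally show ?thesis using * by (meson ennreal_leI order_trans)
  qed auto
  thus ?thesis by (simp add: F_def G_def)
qed

text \<open>An infinite integral counts as 0 here because of \<^const>\<open>enn2real\<close>. This makes
  the induction on the dimension go through, where sections with infinite integral occur on a null
  set.\<close>

lemma prekopa_leindler_real:
  fixes f g :: "real \<Rightarrow> real" and h :: "real \<Rightarrow> ennreal"
  assumes [measurable]: "f \<in> borel_measurable borel" "g \<in> borel_measurable borel"
      "h \<in> borel_measurable borel"
    and f: "\<And>x. 0 \<le> f x" and g: "\<And>x. 0 \<le> g x"
    and l: "0 < l" "l < 1"
    and le: "\<And>x y. ennreal (f x powr l * g y powr (1 - l)) \<le> h (l * x + (1 - l) * y)"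
  shows "ennreal (enn2real (\<integral>\<^sup>+x. f x \<partial>lborel) powr l * enn2real (\<integral>\<^sup>+x. g x \<partial>lborel) powr (1 - l))
           \<le> (\<integral>\<^sup>+x. h x \<partial>lborel)"
proof (cases "(\<integral>\<^sup>+x. f x \<partial>lborel) = \<infinity> \<or> (\<integral>\<^sup>+x. g x \<partial>lborel) = \<infinity>")
  case True
  thus ?thesis by auto
next
  case False
  have trunc: "(\<lambda>n. enn2real (\<integral>\<^sup>+x. min (u x) (real n) \<partial>lborel)) \<longlonglongrightarrow> enn2real (\<integral>\<^sup>+x. u x \<partial>lborel)"
      "\<And>n. (\<integral>\<^sup>+x. min (u x) (real n) \<partial>lborel) < \<infinity>"
    if [measurable]: "u \<in> borel_measurable borel" and u: "\<And>x. 0 \<le> u x"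
      and fin: "(\<integral>\<^sup>+x. u x \<partial>lborel) \<noteq> \<infinity>" for u :: "real \<Rightarrow> real"
  proof -
    have "(\<lambda>n. \<integral>\<^sup>+x. min (u x) (real n) \<partial>lborel) \<longlonglongrightarrow> (\<integral>\<^sup>+x. u x \<partial>lborel)"
    proof (rule nn_integral_LIMSEQ)
      show "incseq (\<lambda>n x. ennreal (min (u x) (real n)))"
        by (auto simp: incseq_def le_fun_def intro!: ennreal_leI)
      fix x
      obtain N where "u x \<le> real N" using real_arch_simple by blast
      hence "\<forall>\<^sub>F n in sequentially. ennreal (min (u x) (real n)) = ennreal (u x)"
        unfolding eventually_sequentially by (intro exI[of _ N]) (auto simp: min_def)
      thus "(\<lambda>n. ennreal (min (u x) (real n))) \<longlonglongrightarrow> ennreal (u x)"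
        by (rule tendsto_eventually)
    qed auto
    thus "(\<lambda>n. enn2real (\<integral>\<^sup>+x. min (u x) (real n) \<partial>lborel)) \<longlonglongrightarrow> enn2real (\<integral>\<^sup>+x. u x \<partial>lborel)"
      using fin by (intro tendsto_enn2real) (auto simp: top.not_eq_extremum)
    show "(\<integral>\<^sup>+x. min (u x) (real n) \<partial>lborel) < \<infinity>" for n
    proof -
      have "(\<integral>\<^sup>+x. min (u x) (real n) \<partial>lborel) \<le> (\<integral>\<^sup>+x. u x \<partial>lborel)"
        by (intro nn_integral_mono ennreal_leI) auto
      thus ?thesis using fin by (auto simp: top.not_eq_extremum)
    qed
  qed
  \<comment> \<open>Cutting \<open>f\<close> and \<open>g\<close> at height \<open>n\<close> only
    lowers the left side of \<open>le\<close>, so the same \<open>h\<close> serves for every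
    \<open>n\<close>.\<close>
  have "ennreal (enn2real (\<integral>\<^sup>+x. min (f x) (real n) \<partial>lborel) powr l
        * enn2real (\<integral>\<^sup>+x. min (g x) (real n) \<partial>lborel) powr (1 - l)) \<le> (\<integral>\<^sup>+x. h x \<partial>lborel)" for n
  proof (rule prekopa_leindler_real_bounded[where K = "real n"])
    fix x y
    have "min (f x) (real n) powr l * min (g y) (real n) powr (1 - l) \<le> f x powr l * g y powr (1 - l)"
      using f g l by (intro mult_mono powr_mono2) auto
    thus "ennreal (min (f x) (real n) powr l * min (g y) (real n) powr (1 - l)) \<le> h (l * x + (1 - l) * y)"
      using le[of x y] by (meson ennreal_leI order_trans)
  qed (use f g l False trunc(2) in auto)
  note le' = this
  have "(\<lambda>n. ennreal (enn2real (\<integral>\<^sup>+x. min (f x) (real n) \<partial>lborel) powr l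
        * enn2real (\<integral>\<^sup>+x. min (g x) (real n) \<partial>lborel) powr (1 - l)))
     \<longlonglongrightarrow> ennreal (enn2real (\<integral>\<^sup>+x. f x \<partial>lborel) powr l * enn2real (\<integral>\<^sup>+x. g x \<partial>lborel) powr (1 - l))"
    using False f g l by (intro tendsto_ennrealI tendsto_mult tendsto_powr2 trunc(1) tendsto_const) auto
  thus ?thesis by (rule LIMSEQ_le_const2) (use le' in blast)
qed

text \<open>Tensorisation: for fixed \<open>x\<close> and \<open>y\<close> in the remaining
  coordinates, the one-dimensional inequality for the sections of \<open>f\<close>, \<open>g\<close>
  and \<open>h\<close> in direction \<open>i\<close> is precisely the hypothesis of the induction
  for the partial integrals \<open>F\<close>, \<open>G\<close> and \<open>H\<close>.\<close>

lemma prekopa_leindler_PiM: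
  fixes f g :: "('i \<Rightarrow> real) \<Rightarrow> real" and h :: "('i \<Rightarrow> real) \<Rightarrow> ennreal"
  assumes "finite I" and "f \<in> borel_measurable (PiM I (\<lambda>_. lborel))"
      "g \<in> borel_measurable (PiM I (\<lambda>_. lborel))" "h \<in> borel_measurable (PiM I (\<lambda>_. lborel))"
    and "\<And>x. 0 \<le> f x" and "\<And>x. 0 \<le> g x"
    and l: "0 < l" "l < 1"
    and "\<And>x y. x \<in> space (PiM I (\<lambda>_. lborel)) \<Longrightarrow> y \<in> space (PiM I (\<lambda>_. lborel)) \<Longrightarrow>
      ennreal (f x powr l * g y powr (1 - l)) \<le> h (\<lambda>i\<in>I. l * x i + (1 - l) * y i)"
  shows "ennreal (enn2real (\<integral>\<^sup>+x. f x \<partial>PiM I (\<lambda>_. lborel)) powr l *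
           enn2real (\<integral>\<^sup>+x. g x \<partial>PiM I (\<lambda>_. lborel)) powr (1 - l)) \<le> (\<integral>\<^sup>+x. h x \<partial>PiM I (\<lambda>_. lborel))"
  using assms(1-6,9)
proof (induction I arbitrary: f g h rule: finite_induct)
  case empty
  show ?case using empty.prems(6)[of "\<lambda>_. undefined" "\<lambda>_. undefined"] empty.prems(4,5)
    by (simp add: PiM_empty nn_integral_count_space_finite restrict_def)
next
  case (insert i I)
  note [measurable] = insert.prems(1-3)
  interpret product_sigma_finite "\<lambda>_::'i. lborel :: real measure" ..
  let ?M = "PiM I (\<lambda>_. lborel :: real measure)"
  let ?N = "PiM (insert i I) (\<lambda>_. lborel :: real measure)"
  define F where "F x = (\<integral>\<^sup>+t. f (x(i := t)) \<partial>lborel)" for x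
  define G where "G x = (\<integral>\<^sup>+t. g (x(i := t)) \<partial>lborel)" for x
  define H where "H x = (\<integral>\<^sup>+t. h (x(i := t)) \<partial>lborel)" for x
  have [measurable]: "F \<in> borel_measurable ?M" "G \<in> borel_measurable ?M" "H \<in> borel_measurable ?M"
    unfolding F_def G_def H_def by measurable
  have eq: "(\<integral>\<^sup>+x. f x \<partial>?N) = (\<integral>\<^sup>+x. F x \<partial>?M)" "(\<integral>\<^sup>+x. g x \<partial>?N) = (\<integral>\<^sup>+x. G x \<partial>?M)"
     "(\<integral>\<^sup>+x. h x \<partial>?N) = (\<integral>\<^sup>+x. H x \<partial>?M)"
    unfolding F_def G_def H_def using insert.hyps by (subst product_nn_integral_insert; simp)+
  show ?case
  proof (cases "(\<integral>\<^sup>+x. F x \<partial>?M) = \<infinity> \<or> (\<integral>\<^sup>+x. G x \<partial>?M) = \<infinity>")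
    case True
    thus ?thesis by (auto simp: eq)
  next
    case False
    \<comment> \<open>The induction hypothesis takes real functions, whereas partial integrals may
      be infinite. With finite total integral this happens only on a null set, where
      \<open>enn2real\<close> puts 0.\<close>
    have fin: "AE x in ?M. u x = ennreal (enn2real (u x))"
      if "u \<in> borel_measurable ?M" "(\<integral>\<^sup>+x. u x \<partial>?M) \<noteq> \<infinity>" for u
      using nn_integral_PInf_AE[OF that] by eventually_elim (simp add: less_top)
    have "AE x in ?M. F x = ennreal (enn2real (F x))" "AE x in ?M. G x = ennreal (enn2real (G x))"
      using False by (auto intro!: fin)
    hence "(\<integral>\<^sup>+x. F x \<partial>?M) = (\<integral>\<^sup>+x. enn2real (F x) \<partial>?M)" "(\<integral>\<^sup>+x. G x \<partial>?M) = (\<integral>\<^sup>+x. enn2real (G x) \<partial>?M)"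
      by (auto intro!: nn_integral_cong_AE)
    moreover have "ennreal (enn2real (\<integral>\<^sup>+x. enn2real (F x) \<partial>?M) powr l *
        enn2real (\<integral>\<^sup>+x. enn2real (G x) \<partial>?M) powr (1 - l)) \<le> (\<integral>\<^sup>+x. H x \<partial>?M)"
    proof (rule insert.IH)
      fix x y assume xy: "x \<in> space ?M" "y \<in> space ?M"
      let ?z = "\<lambda>i\<in>I. l * x i + (1 - l) * y i"
      have z: "?z \<in> space ?M" by (auto simp: space_PiM)
      have m: "(\<lambda>t. x(i := t)) \<in> borel \<rightarrow>\<^sub>M ?N" if "x \<in> space ?M" for x
        using that measurable_component_update[of x I "\<lambda>_. lborel" i] insert.hyps by simp
      show "ennreal (enn2real (F x) powr l * enn2real (G y) powr (1 - l)) \<le> H ?z"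
        unfolding F_def G_def H_def
      proof (rule prekopa_leindler_real)
        show "(\<lambda>t. f (x(i := t))) \<in> borel_measurable borel" "(\<lambda>t. g (y(i := t))) \<in> borel_measurable borel"
          "(\<lambda>t. h (?z(i := t))) \<in> borel_measurable borel"
          using xy z by (auto intro!: measurable_compose[OF m])
        fix s t :: real
        have "x(i := s) \<in> space ?N" "y(i := t) \<in> space ?N"
          using xy by (auto simp: space_PiM PiE_def extensional_def)
        moreover have "(\<lambda>j\<in>insert i I. l * (x(i := s)) j + (1 - l) * (y(i := t)) j)
            = ?z(i := l * s + (1 - l) * t)"
          using insert.hyps by (auto simp: fun_eq_iff)
        ultimately show "ennreal (f (x(i := s)) powr l * g (y(i := t)) powr (1 - l))
            \<le> h (?z(i := l * s + (1 - l) * t))"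
          using insert.prems(6)[of "x(i := s)" "y(i := t)"] by (simp only:)
      qed (use insert.prems l in auto)
    qed auto
    ultimately show ?thesis by (simp add: eq)
  qed
qed

theorem prekopa_leindler:
  fixes f g :: "'a::euclidean_space \<Rightarrow> real" and h :: "'a \<Rightarrow> ennreal"
  assumes [measurable]: "f \<in> borel_measurable borel" "g \<in> borel_measurable borel"
      "h \<in> borel_measurable borel"
    and f: "\<And>x. 0 \<le> f x" and g: "\<And>x. 0 \<le> g x"
    and l: "0 < l" "l < 1"
    and le: "\<And>x y. ennreal (f x powr l * g y powr (1 - l)) \<le> h (l *\<^sub>R x + (1 - l) *\<^sub>R y)"
  shows "ennreal (enn2real (\<integral>\<^sup>+x. f x \<partial>lborel) powr l * enn2real (\<integral>\<^sup>+x. g x \<partial>lborel) powr (1 - l))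
           \<le> (\<integral>\<^sup>+x. h x \<partial>lborel)"
proof -
  let ?M = "PiM Basis (\<lambda>_. lborel) :: ('a \<Rightarrow> real) measure"
  let ?T = "\<lambda>x::'a \<Rightarrow> real. \<Sum>b\<in>Basis. x b *\<^sub>R b"
  have [measurable]: "?T \<in> ?M \<rightarrow>\<^sub>M borel" by measurable
  have eq: "(\<integral>\<^sup>+x. u x \<partial>lborel) = (\<integral>\<^sup>+x. u (?T x) \<partial>?M)" if "u \<in> borel_measurable borel" for u :: "'a \<Rightarrow> ennreal"
    using that by (subst lborel_eq) (simp add: nn_integral_distr)
  have "ennreal (enn2real (\<integral>\<^sup>+x. f (?T x) \<partial>?M) powr l * enn2real (\<integral>\<^sup>+x. g (?T x) \<partial>?M) powr (1 - l))
           \<le> (\<integral>\<^sup>+x. h (?T x) \<partial>?M)"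
  proof (rule prekopa_leindler_PiM)
    fix x y :: "'a \<Rightarrow> real"
    have "?T (\<lambda>i\<in>Basis. l * x i + (1 - l) * y i) = l *\<^sub>R ?T x + (1 - l) *\<^sub>R ?T y"
      by (simp add: scaleR_sum_right sum.distrib[symmetric] scaleR_add_left)
    thus "ennreal (f (?T x) powr l * g (?T y) powr (1 - l)) \<le> h (?T (\<lambda>i\<in>Basis. l * x i + (1 - l) * y i))"
      using le[of "?T x" "?T y"] by simp
  qed (use f g l in auto)
  thus ?thesis by (simp add: eq)
qed

subsection \<open>Moments and tails\<close>

text \<open>The power is integrated up from 0 for \<open>p > 0\<close> and down from infinity for
  \<open>p < 0\<close>. The choice of open and closed ends makes the two index sets, read as
  conditions on \<open>y\<close>, complementary: \<open>s < y\<close> and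
  \<open>y \<le> s\<close>.\<close>

lemma powr_eq_nn_integral:
  fixes p y :: real
  assumes p: "p \<noteq> 0" and y: "y > 0"
  shows "ennreal (y powr p) = (\<integral>\<^sup>+s. indicator {0<..} s * ennreal (\<bar>p\<bar> * s powr (p - 1)) *
           indicator (if p > 0 then {..<y} else {y..}) s \<partial>lborel)"
proof (cases "p > 0")
  case True
  have "((\<lambda>x. x powr (p - 1)) has_integral (y powr (p - 1 + 1) / (p - 1 + 1))) {0..y}"
    using True y by (intro has_integral_powr_from_0) auto
  hence "((\<lambda>x. p * x powr (p - 1)) has_integral (p * (y powr p / p))) {0..y}"
    by (intro has_integral_mult_right) simp
  hence "(\<integral>\<^sup>+s. ennreal (p * s powr (p - 1)) * indicator {0..y} s \<partial>lborel) = ennreal (y powr p)"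
    using True by (subst nn_integral_has_integral_lebesgue') auto
  moreover have "AE s in lborel. s \<noteq> y" "AE s in lborel. s \<noteq> (0::real)" by (auto intro: AE_lborel_singleton)
  hence "AE s in lborel. ennreal (p * s powr (p - 1)) * indicator {0..y} s =
      indicator {0<..} s * ennreal (p * s powr (p - 1)) * indicator {..<y} s"
    by eventually_elim (auto simp: indicator_def)
  ultimately show ?thesis using True by (simp add: nn_integral_cong_AE)
next
  case False
  have "((\<lambda>x. x powr (p - 1)) has_integral (- (y powr (p - 1 + 1)) / (p - 1 + 1))) {y..}"
    using False p y by (intro has_integral_powr_to_inf) auto
  hence "((\<lambda>x. - p * x powr (p - 1)) has_integral (- p * (- (y powr p) / p))) {y..}"
    by (intro has_integral_mult_right) simp
  hence "(\<integral>\<^sup>+s. ennreal (- p * s powr (p - 1)) * indicator {y..} s \<partial>lborel) = ennreal (y powr p)"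
    using False p by (subst nn_integral_has_integral_lebesgue') (auto simp: mult_nonpos_nonneg)
  moreover have "ennreal (- p * s powr (p - 1)) * indicator {y..} s =
      indicator {0<..} s * ennreal (- p * s powr (p - 1)) * indicator {y..} s" for s
    using y by (auto simp: indicator_def)
  ultimately show ?thesis using False p by simp
qed

text \<open>This is the factor that turns the weight \<open>\<bar>p\<bar> * s powr (p - 1)\<close>
  into the \<open>p\<close>-th moment: the tail for positive \<open>p\<close>, the distribution
  function for negative \<open>p\<close>.\<close>

definition layer_prob :: "'a measure \<Rightarrow> ('a \<Rightarrow> real) \<Rightarrow> real \<Rightarrow> real \<Rightarrow> real" where
  "layer_prob M X p s = (if p > 0 then \<P>(x in M. s < X x) else \<P>(x in M. X x \<le> s))"

lemma (in prob_space) layer_prob_compl: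
  assumes "random_variable borel X"
  shows "layer_prob M X p s = (if p > 0 then \<P>(x in M. s < X x) else 1 - \<P>(x in M. s < X x))"
proof -
  have "\<P>(x in M. X x \<le> s) = 1 - \<P>(x in M. s < X x)"
    using prob_neg[of "\<lambda>x. s < X x"] assms by (simp add: not_less)
  thus ?thesis by (simp add: layer_prob_def)
qed

lemma (in prob_space) borel_measurable_layer_prob:
  assumes [measurable]: "random_variable borel X"
  shows "layer_prob M X p \<in> borel_measurable borel"
proof -
  have "layer_prob M X p = (\<lambda>s. if p > 0 then measure M {x\<in>space M. s < X x} else measure M {x\<in>space M. X x \<le> s})"
    by (auto simp: layer_prob_def fun_eq_iff)
  also have "\<dots> \<in> borel_measurable borel" by measurable
  finally show ?thesis .
qed

text \<open>Fubini applied to \<open>powr_eq_nn_integral\<close>. The form in \<open>ennreal\<close>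
  presupposes no finite moment, so it can later serve to prove finiteness. Positivity of
  \<open>X\<close> matters for \<open>p < 0\<close>: real \<open>powr\<close> is 0 at 0, where the
  layer integral is infinite.\<close>

lemma (in prob_space) nn_moment_layer_cake:
  assumes [measurable]: "random_variable borel X" and pos: "AE x in M. 0 < X x" and p: "p \<noteq> 0"
  shows "(\<integral>\<^sup>+x. ennreal (X x powr p) \<partial>M) =
    (\<integral>\<^sup>+s. ennreal (indicator {0<..} s * (\<bar>p\<bar> * s powr (p - 1) * layer_prob M X p s)) \<partial>lborel)"
proof -
  interpret P: pair_sigma_finite lborel M ..
  let ?w = "\<lambda>s. indicator {0<..} s * ennreal (\<bar>p\<bar> * s powr (p - 1))"
  let ?L = "\<lambda>x. if p > 0 then {..<X x} else {X x..}"
  have [measurable]: "(\<lambda>(s, x). indicator (?L x) s :: ennreal) \<in> borel_measurable (lborel \<Otimes>\<^sub>M M)"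
  proof (cases "p > 0")
    case True
    have "(\<lambda>(s, x). indicator (?L x) s :: ennreal) = (\<lambda>z. if fst z < X (snd z) then 1 else 0)"
      using True by (auto simp: fun_eq_iff indicator_def)
    thus ?thesis by simp
  next
    case False
    have "(\<lambda>(s, x). indicator (?L x) s :: ennreal) = (\<lambda>z. if fst z \<ge> X (snd z) then 1 else 0)"
      using False by (auto simp: fun_eq_iff indicator_def)
    thus ?thesis by simp
  qed
  have "(\<integral>\<^sup>+x. ennreal (X x powr p) \<partial>M) = (\<integral>\<^sup>+x. \<integral>\<^sup>+s. ?w s * indicator (?L x) s \<partial>lborel \<partial>M)"
    using pos by (intro nn_integral_cong_AE) (auto simp: powr_eq_nn_integral[OF p])
  also have "\<dots> = (\<integral>\<^sup>+s. \<integral>\<^sup>+x. ?w s * indicator (?L x) s \<partial>M \<partial>lborel)"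
    by (rule P.Fubini') measurable
  also have "\<dots> = (\<integral>\<^sup>+s. ennreal (indicator {0<..} s * (\<bar>p\<bar> * s powr (p - 1) * layer_prob M X p s)) \<partial>lborel)"
  proof (intro nn_integral_cong)
    fix s :: real
    have "(\<integral>\<^sup>+x. ?w s * indicator (?L x) s \<partial>M) = ?w s * (\<integral>\<^sup>+x. indicator (?L x) s \<partial>M)"
      by (rule nn_integral_cmult) measurable
    also have "(\<integral>\<^sup>+x. indicator (?L x) s \<partial>M) =
        (\<integral>\<^sup>+x. indicator (if p > 0 then {x\<in>space M. s < X x} else {x\<in>space M. X x \<le> s}) x \<partial>M)"
      by (intro nn_integral_cong) (auto simp: indicator_def)
    also have "\<dots> = ennreal (layer_prob M X p s)"
      by (subst nn_integral_indicator) (auto simp: layer_prob_def emeasure_eq_measure)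
    also have "?w s * \<dots> = ennreal (indicator {0<..} s * (\<bar>p\<bar> * s powr (p - 1) * layer_prob M X p s))"
      by (auto simp: indicator_def ennreal_mult layer_prob_def)
    finally show "(\<integral>\<^sup>+x. ?w s * indicator (?L x) s \<partial>M) = \<dots>" .
  qed
  finally show ?thesis .
qed

lemma (in prob_space) moment_layer_cake:
  assumes [measurable]: "random_variable borel X" and pos: "AE x in M. 0 < X x" and p: "p \<noteq> 0"
    and int: "integrable M (\<lambda>x. X x powr p)"
  shows "has_bochner_integral lborel
    (\<lambda>s. indicator {0<..} s * (\<bar>p\<bar> * s powr (p - 1) * layer_prob M X p s)) (expectation (\<lambda>x. X x powr p))"
proof (rule has_bochner_integral_nn_integral)
  note [measurable] = borel_measurable_layer_prob[OF assms(1)]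
  show "(\<lambda>s. indicator {0<..} s * (\<bar>p\<bar> * s powr (p - 1) * layer_prob M X p s)) \<in> borel_measurable lborel"
    by measurable
  show "(\<integral>\<^sup>+s. ennreal (indicator {0<..} s * (\<bar>p\<bar> * s powr (p - 1) * layer_prob M X p s)) \<partial>lborel)
      = ennreal (expectation (\<lambda>x. X x powr p))"
    using int by (subst nn_moment_layer_cake[symmetric]) (use pos p in \<open>auto simp: nn_integral_eq_integral\<close>)
qed (auto simp: layer_prob_def)

text \<open>For \<open>p < 0\<close> both layer probabilities are 1 minus a tail. The ones cancel in
  the difference, and the remaining minus sign cancels against that of \<open>p\<close>.\<close>

lemma moment_diff:
  fixes X :: "'a \<Rightarrow> real" and Y :: "'b \<Rightarrow> real"
  assumes M: "prob_space M" and N: "prob_space N"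
    and [measurable]: "X \<in> borel_measurable M" "Y \<in> borel_measurable N"
    and pos: "AE x in M. 0 < X x" "AE x in N. 0 < Y x" and p: "p \<noteq> 0"
    and int: "integrable M (\<lambda>x. X x powr p)" "integrable N (\<lambda>x. Y x powr p)"
  shows "has_bochner_integral lborel
    (\<lambda>s. indicator {0<..} s * (s powr (p - 1) * (\<P>(x in M. s < X x) - \<P>(x in N. s < Y x))))
    (((\<integral>x. X x powr p \<partial>M) - (\<integral>x. Y x powr p \<partial>N)) / p)"
proof -
  interpret M: prob_space M by fact
  interpret N: prob_space N by fact
  have "has_bochner_integral lborel
    (\<lambda>s. (indicator {0<..} s * (\<bar>p\<bar> * s powr (p - 1) * layer_prob M X p s) -
         indicator {0<..} s * (\<bar>p\<bar> * s powr (p - 1) * layer_prob N Y p s)) / p)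
    (((\<integral>x. X x powr p \<partial>M) - (\<integral>x. Y x powr p \<partial>N)) / p)"
    using assms by (intro has_bochner_integral_divide_zero has_bochner_integral_diff
        M.moment_layer_cake N.moment_layer_cake) auto
  also have "(\<lambda>s. (indicator {0<..} s * (\<bar>p\<bar> * s powr (p - 1) * layer_prob M X p s) -
         indicator {0<..} s * (\<bar>p\<bar> * s powr (p - 1) * layer_prob N Y p s)) / p) =
    (\<lambda>s. indicator {0<..} s * (s powr (p - 1) * (\<P>(x in M. s < X x) - \<P>(x in N. s < Y x))))"
    using p by (auto simp: fun_eq_iff M.layer_prob_compl N.layer_prob_compl field_simps)
  finally show ?thesis .
qed

text \<open>With \<open>D\<close> the difference of the tails, \<open>(s\<^bsup>q-p\<^esup> - s0\<^bsup>q-p\<^esup>) * D s \<le> 0\<close> for all \<open>s > 0\<close>.\<close>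

lemma moment_single_crossing:
  fixes X :: "'a \<Rightarrow> real" and Y :: "'b \<Rightarrow> real"
  assumes M: "prob_space M" and N: "prob_space N"
    and [measurable]: "X \<in> borel_measurable M" "Y \<in> borel_measurable N"
    and pos: "AE x in M. 0 < X x" "AE x in N. 0 < Y x"
    and pq: "p \<noteq> 0" "q \<noteq> 0" "p < q"
    and intp: "integrable M (\<lambda>x. X x powr p)" "integrable N (\<lambda>x. Y x powr p)"
    and intq: "integrable M (\<lambda>x. X x powr q)" "integrable N (\<lambda>x. Y x powr q)"
    and s0: "0 \<le> s0"
    and before: "\<And>s. 0 < s \<Longrightarrow> s < s0 \<Longrightarrow> \<P>(x in N. s < Y x) \<le> \<P>(x in M. s < X x)"
    and after: "\<And>s. s0 < s \<Longrightarrow> \<P>(x in M. s < X x) \<le> \<P>(x in N. s < Y x)"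
  shows "((\<integral>x. X x powr q \<partial>M) - (\<integral>x. Y x powr q \<partial>N)) / q \<le>
    s0 powr (q - p) * (((\<integral>x. X x powr p \<partial>M) - (\<integral>x. Y x powr p \<partial>N)) / p)"
proof -
  define D where "D s = \<P>(x in M. s < X x) - \<P>(x in N. s < Y x)" for s
  have hq: "has_bochner_integral lborel (\<lambda>s. indicator {0<..} s * (s powr (q - 1) * D s))
      (((\<integral>x. X x powr q \<partial>M) - (\<integral>x. Y x powr q \<partial>N)) / q)"
    unfolding D_def by (rule moment_diff) (use assms in auto)
  have "has_bochner_integral lborel (\<lambda>s. indicator {0<..} s * (s powr (p - 1) * D s))
      (((\<integral>x. X x powr p \<partial>M) - (\<integral>x. Y x powr p \<partial>N)) / p)"
    unfolding D_def by (rule moment_diff) (use assms in auto)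
  hence hp: "has_bochner_integral lborel
      (\<lambda>s. s0 powr (q - p) * (indicator {0<..} s * (s powr (p - 1) * D s)))
      (s0 powr (q - p) * (((\<integral>x. X x powr p \<partial>M) - (\<integral>x. Y x powr p \<partial>N)) / p))"
    by (intro has_bochner_integral_mult_right) auto
  have "(\<integral>s. indicator {0<..} s * (s powr (q - 1) * D s) \<partial>lborel) \<le>
      (\<integral>s. s0 powr (q - p) * (indicator {0<..} s * (s powr (p - 1) * D s)) \<partial>lborel)"
  proof (rule integral_mono)
    fix s :: real
    have "s powr (q - 1) * D s \<le> s0 powr (q - p) * (s powr (p - 1) * D s)" if "s > 0"
    proof -
      \<comment> \<open>At \<open>s = s0\<close> the first factor vanishes, so the order of the
        tails at the crossing itself is irrelevant. The case \<open>s0 = 0\<close> is sound, since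
        \<open>0 powr (q - p) = 0\<close> is the true value for \<open>q - p > 0\<close>.\<close>
      have "(s powr (q - p) - s0 powr (q - p)) * D s \<le> 0"
      proof (cases s s0 rule: linorder_cases)
        case less
        thus ?thesis using before[of s] that pq
          by (intro mult_nonpos_nonneg) (auto simp: D_def intro!: powr_mono2)
      next
        case greater
        thus ?thesis using after[of s] s0 pq
          by (intro mult_nonneg_nonpos) (auto simp: D_def intro!: powr_mono2)
      qed simp
      hence "s powr (p - 1) * ((s powr (q - p) - s0 powr (q - p)) * D s) \<le> 0"
        by (rule mult_nonneg_nonpos[rotated]) auto
      moreover have "s powr (q - 1) = s powr (p - 1) * s powr (q - p)"
        using that by (simp add: powr_add[symmetric])
      ultimately show ?thesis by (simp add: algebra_simps)
    qed
    thus "indicator {0<..} s * (s powr (q - 1) * D s)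
       \<le> s0 powr (q - p) * (indicator {0<..} s * (s powr (p - 1) * D s))"
      by (auto simp: indicator_def)
  qed (use hp hq in \<open>simp_all add: has_bochner_integral_iff\<close>)
  thus ?thesis using hp hq by (simp add: has_bochner_integral_iff)
qed

section \<open>Exponential variables and a bound for differentiating powers in the exponent\<close>

abbreviation std_exponential :: "real measure" where
  "std_exponential \<equiv> density lborel (exponential_density 1)"

lemma prob_space_std_exponential: "prob_space std_exponential"
  by (rule prob_space_exponential_density) simp

lemma AE_std_exponential_pos: "AE t in std_exponential. 0 < t"
proof -
  have "AE t in lborel. t \<noteq> (0::real)" by (rule AE_lborel_singleton)
  thus ?thesis by (subst AE_density) (auto simp: exponential_density_def)
qed

lemma std_exponential_tail:
  assumes "c > 0" "s \<ge> 0"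
  shows "measure std_exponential {t. s < c * t} = exp (- s / c)"
proof -
  interpret prob_space std_exponential by (rule prob_space_std_exponential)
  have "distributed std_exponential lborel (\<lambda>x. x) (exponential_density 1)"
    by (auto simp: distributed_def distr_id2)
  from exponential_distributedD_gt[OF this, of "s / c"] show ?thesis
    using assms by (simp add: field_simps)
qed

lemma nn_integral_std_exponential_powr:
  assumes "c > 0" "p > -1"
  shows "(\<integral>\<^sup>+t. ennreal ((c * t) powr p) \<partial>std_exponential) = ennreal (c powr p * Gamma (1 + p))"
proof -
  have "(\<integral>\<^sup>+t. ennreal ((c * t) powr p) \<partial>std_exponential)
      = (\<integral>\<^sup>+t. ennreal (exponential_density 1 t) * ennreal ((c * t) powr p) \<partial>lborel)"
    by (rule nn_integral_density) auto
  also have "\<dots> = (\<integral>\<^sup>+t. ennreal (c powr p) * ennreal (indicator {0..} t * t powr (1 + p - 1) / exp t) \<partial>lborel)"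
    using assms by (intro nn_integral_cong)
      (auto simp: exponential_density_def ennreal_mult[symmetric] indicator_def powr_mult exp_minus field_simps)
  also have "\<dots> = ennreal (c powr p) * ennreal (Gamma (1 + p))"
    using assms by (subst nn_integral_cmult) (auto simp: Gamma_conv_nn_integral_real)
  finally show ?thesis by (simp add: ennreal_mult')
qed

lemma std_exponential_powr:
  assumes "c > 0" "p > -1"
  shows "integrable std_exponential (\<lambda>t. (c * t) powr p)"
    and "(\<integral>t. (c * t) powr p \<partial>std_exponential) = c powr p * Gamma (1 + p)"
proof -
  have "has_bochner_integral std_exponential (\<lambda>t. (c * t) powr p) (c powr p * Gamma (1 + p))"
    using nn_integral_std_exponential_powr[OF assms] assms
    by (intro has_bochner_integral_nn_integral) (auto simp: Gamma_real_pos less_imp_le)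
  thus "integrable std_exponential (\<lambda>t. (c * t) powr p)"
    and "(\<integral>t. (c * t) powr p \<partial>std_exponential) = c powr p * Gamma (1 + p)"
    by (auto simp: has_bochner_integral_iff)
qed

text \<open>A dominating function for the derivative of the moments at exponent 0; the exponents
  \<open>1/2\<close> and \<open>- 1/2\<close> lie above -1, so it will be integrable. For
  \<open>p > 0\<close> the quotient lies between \<open>ln y\<close> and its value at
  \<open>p = 1/2\<close>, the latter by Young's inequality for \<open>y powr (1/2)\<close> and 1
  with weights \<open>2 * p\<close> and \<open>1 - 2 * p\<close>. For \<open>p < 0\<close>,
  \<open>y\<close> is replaced by its inverse.\<close>

lemma abs_powr_diff_quotient_le:
  fixes y p :: real
  assumes y: "0 < y" and p: "p \<noteq> 0" "\<bar>p\<bar> \<le> 1 / 2"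
  shows "\<bar>(y powr p - 1) / p\<bar> \<le> 2 * (y powr (1/2) + y powr (- 1/2))"
proof -
  have main: "\<bar>(z powr r - 1) / r\<bar> \<le> 2 * (z powr (1/2) + z powr (- 1/2))"
    if z: "0 < z" and r: "0 < r" "r \<le> 1 / 2" for z r :: real
  proof -
    have up: "(u powr s - 1) / s \<le> 2 * (u powr (1/2) - 1)"
      if "0 < u" "0 < s" "s \<le> 1 / 2" for u s :: real
    proof -
      have "(u powr (1/2)) powr (2 * s) * 1 powr (1 - 2 * s) \<le> 2 * s * u powr (1/2) + (1 - 2 * s) * 1"
        using that by (intro Youngs_inequality_0) auto
      thus ?thesis using that by (simp add: powr_powr field_simps)
    qed
    have "ln z \<le> (z powr r - 1) / r"
      using exp_ge_add_one_self[of "r * ln z"] z r by (simp add: powr_def field_simps)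
    moreover have "- ln z \<le> 2 * (z powr (- 1/2) - 1)"
      using exp_ge_add_one_self[of "- (1/2) * ln z"] z by (simp add: powr_def)
    moreover have "0 < z powr (1/2)" "0 < z powr (-1/2)" using z by simp_all
    ultimately show ?thesis using up[OF z r] unfolding abs_le_iff by argo
  qed
  show ?thesis
  proof (cases "p > 0")
    case False
    have "(inverse y powr (- p) - 1) / (- p) = - ((y powr p - 1) / p)"
      using y by (simp add: powr_minus inverse_powr[symmetric] powr_def ln_inverse)
    thus ?thesis using main[of "inverse y" "- p"] False p y
      by (simp add: powr_def ln_inverse)
  qed (use main y p in auto)
qed

text \<open>The comparison with the tails of exponential variables only needs this log-star-shapedness
  of the tail, a weakening of log-concavity.\<close>

locale log_star_tail = prob_space M for M :: "'a measure" +
  fixes X :: "'a \<Rightarrow> real"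
  assumes X_measurable [measurable]: "random_variable borel X"
    and X_pos: "\<And>x. 0 < X x"
    and tail_star: "\<And>l s. 0 < l \<Longrightarrow> l < 1 \<Longrightarrow> 0 < s \<Longrightarrow>
      \<P>(x in M. s < X x) powr l \<le> \<P>(x in M. l * s < X x)"
begin

lemma X_neq_0 [simp]: "X x \<noteq> 0"
  using X_pos[of x] by simp

definition tail :: "real \<Rightarrow> real" where "tail s = \<P>(x in M. s < X x)"

text \<open>Constantly \<open>c\<close> for an exponential variable with mean \<open>c\<close>,
  which is the reason for the factor \<open>Gamma (1 + p)\<close>. The value at \<open>p = 0\<close>
  is junk, because the outer exponent is then 0.\<close>

definition gamma_mean :: "real \<Rightarrow> real" where
  "gamma_mean p = (expectation (\<lambda>x. X x powr p) / Gamma (1 + p)) powr (1 / p)"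

text \<open>Exponential tails give equality in \<open>tail_star\<close>:
  \<open>exp (- s / c)\<close> is the power \<open>s / t\<close> of \<open>exp (- t / c)\<close>.
  Lying above such a tail at \<open>t\<close> therefore propagates down to every smaller positive
  \<open>s\<close>, which is the single crossing.\<close>

lemma tail_ge_exp:
  assumes "0 < c" "exp (- t / c) \<le> tail t" "0 < s" "s \<le> t"
  shows "exp (- s / c) \<le> tail s"
proof (cases "s = t")
  case False
  have "exp (- s / c) = exp (- t / c) powr (s / t)"
    using assms by (simp add: powr_def)
  also have "\<dots> \<le> tail t powr (s / t)"
    using assms by (intro powr_mono2) auto
  also have "\<dots> \<le> tail (s / t * t)"
    unfolding tail_def using assms False by (intro tail_star) auto
  finally show ?thesis using assms by simp
qed (use assms in simp)

lemma tail_less_exp: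
  assumes "0 < c" "tail t < exp (- t / c)" "0 < t" "t \<le> s"
  shows "tail s < exp (- s / c)"
  using tail_ge_exp[of c s t] assms by (meson not_less less_le_trans)

lemma tail_tendsto_0: "(\<lambda>n. tail (real n)) \<longlonglongrightarrow> 0"
proof -
  define A where "A n = {x \<in> space M. real n < X x}" for n
  have "(\<lambda>n. prob (A n)) \<longlonglongrightarrow> prob (\<Inter>n. A n)"
    by (rule finite_Lim_measure_decseq) (auto simp: A_def decseq_def)
  moreover have "(\<Inter>n. A n) = {}"
  proof -
    have "\<exists>n. X x \<le> real n" for x by (rule real_arch_simple)
    thus ?thesis by (auto simp: A_def not_less[symmetric])
  qed
  ultimately show ?thesis by (simp add: A_def tail_def)
qed

lemma tail_tendsto_1: "(\<lambda>n. tail (1 / real (Suc n))) \<longlonglongrightarrow> 1"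
proof -
  define A where "A n = {x \<in> space M. 1 / real (Suc n) < X x}" for n
  have "incseq A"
  proof (rule incseq_SucI)
    fix n
    have "1 / real (Suc (Suc n)) \<le> 1 / real (Suc n)" by (intro divide_left_mono) auto
    thus "A n \<le> A (Suc n)" by (auto simp: A_def)
  qed
  moreover have "range A \<subseteq> events" by (auto simp: A_def)
  ultimately have "(\<lambda>n. prob (A n)) \<longlonglongrightarrow> prob (\<Union>n. A n)"
    by (intro finite_Lim_measure_incseq)
  moreover have "(\<Union>n. A n) = space M"
  proof -
    have "\<exists>n. 1 / real (Suc n) < X x" for x
      using reals_Archimedean[OF X_pos[of x]] by (simp add: inverse_eq_divide)
    thus ?thesis by (auto simp: A_def)
  qed
  ultimately show ?thesis by (simp add: A_def tail_def prob_space)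
qed

text \<open>Controls the probability of small values of \<open>X\<close>, as the moments of negative
  order require.\<close>

lemma ex_exp_le_tail:
  obtains c t where "0 < c" "0 < t" "\<And>s. 0 < s \<Longrightarrow> s \<le> t \<Longrightarrow> exp (- s / c) \<le> tail s"
proof -
  have "\<forall>\<^sub>F n in sequentially. 0 < tail (1 / real (Suc n))"
    using order_tendstoD(1)[OF tail_tendsto_1] by simp
  then obtain n where n: "0 < tail (1 / real (Suc n))"
    unfolding eventually_sequentially by blast
  define t where "t = 1 / real (Suc n)"
  have t: "0 < t" "0 < tail t" "tail t \<le> 1" using n by (auto simp: t_def tail_def)
  \<comment> \<open>Chosen so that \<open>exp (- t / c) = tail t * exp (- 1)\<close>. The summand 1
    keeps the denominator positive even if \<open>tail t = 1\<close>.\<close>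
  define c where "c = t / (1 - ln (tail t))"
  have "ln (tail t) \<le> 0" using t by simp
  hence "0 < 1 - ln (tail t)" by linarith
  hence c: "0 < c" unfolding c_def using t(1) by (rule divide_pos_pos[rotated])
  have "- t / c = ln (tail t) - 1" using t by (simp add: c_def)
  hence "exp (- t / c) = exp (ln (tail t)) * exp (- 1)"
    by (simp add: exp_diff exp_minus divide_inverse)
  also have "\<dots> \<le> tail t" using t by (simp add: mult_left_le)
  finally show ?thesis using that[of c t] tail_ge_exp[of c t] c t by blast
qed

text \<open>Exponential decay at infinity, as the moments of positive order require. Taking
  \<open>c = t\<close> reduces it to one point where the tail is below
  \<open>exp (- 1)\<close>.\<close>

lemma ex_tail_le_exp:
  obtains c t where "0 < c" "0 < t" "\<And>s. t \<le> s \<Longrightarrow> tail s \<le> exp (- s / c)"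
proof -
  have "\<forall>\<^sub>F n in sequentially. tail (real n) < exp (- 1)"
    using order_tendstoD(2)[OF tail_tendsto_0] by simp
  then obtain n where n: "\<And>m. m \<ge> n \<Longrightarrow> tail (real m) < exp (- 1)"
    unfolding eventually_sequentially by blast
  define t where "t = real (Suc n)"
  have t: "0 < t" by (simp add: t_def)
  hence "exp (- t / t) = exp (- 1)" by simp
  moreover have "tail t < exp (- 1)" using n[of "Suc n"] by (simp add: t_def)
  ultimately show ?thesis using that[of t t] tail_less_exp[of t t] t by (metis less_imp_le)
qed

text \<open>On one side of a threshold \<open>t\<close> the layer probability of \<open>X\<close> is
  bounded by that of an exponential variable, on the other side by 1, which is there the layer
  probability of the constant \<open>t\<close>. Hence the moment is at most the sum of the two
  \<open>p\<close>-th moments \<open>c powr p * Gamma (1 + p)\<close> and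
  \<open>t powr p\<close>.\<close>

lemma integrable_moment:
  assumes p: "-1 < p"
  shows "integrable M (\<lambda>x. X x powr p)"
proof (cases "p = 0")
  case False
  interpret E: prob_space std_exponential by (rule prob_space_std_exponential)
  have "\<exists>c t. 0 < c \<and> 0 < t \<and>
    (\<forall>s>0. layer_prob M X p s \<le> layer_prob std_exponential (\<lambda>u. c * u) p s + layer_prob M (\<lambda>_. t) p s)"
  proof (cases "p > 0")
    case True
    obtain c t where ct: "0 < c" "0 < t" "\<And>s. t \<le> s \<Longrightarrow> tail s \<le> exp (- s / c)"
      by (rule ex_tail_le_exp) blast
    moreover have "layer_prob M (\<lambda>_. t) p s = 1" if "s < t" for s
      using True that by (simp add: layer_prob_def prob_space)
    moreover have "layer_prob M X p s \<le> layer_prob std_exponential (\<lambda>u. c * u) p s" if "0 < s" "t \<le> s" for s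
      using True ct that by (auto simp: layer_prob_def std_exponential_tail tail_def)
    moreover have "0 \<le> layer_prob std_exponential (\<lambda>u. c * u) p s" "0 \<le> layer_prob M (\<lambda>_. t) p s"
      "layer_prob M X p s \<le> 1" for s
      by (auto simp: layer_prob_def)
    ultimately have "layer_prob M X p s \<le>
        layer_prob std_exponential (\<lambda>u. c * u) p s + layer_prob M (\<lambda>_. t) p s" if "0 < s" for s
      using that by (cases "t \<le> s") (smt (verit))+
    thus ?thesis using ct by blast
  next
    case False
    obtain c t where ct: "0 < c" "0 < t" "\<And>s. 0 < s \<Longrightarrow> s \<le> t \<Longrightarrow> exp (- s / c) \<le> tail s"
      by (rule ex_exp_le_tail) blast
    have "layer_prob M (\<lambda>_. t) p s = 1" if "t \<le> s" for s
      using False that by (simp add: layer_prob_def prob_space)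
    moreover have "layer_prob M X p s \<le> layer_prob std_exponential (\<lambda>u. c * u) p s" if "0 < s" "s \<le> t" for s
      using False ct that by (auto simp: layer_prob_compl E.layer_prob_compl std_exponential_tail tail_def)
    moreover have "0 \<le> layer_prob std_exponential (\<lambda>u. c * u) p s" "0 \<le> layer_prob M (\<lambda>_. t) p s"
      "layer_prob M X p s \<le> 1" for s
      by (auto simp: layer_prob_def)
    ultimately have "layer_prob M X p s \<le>
        layer_prob std_exponential (\<lambda>u. c * u) p s + layer_prob M (\<lambda>_. t) p s" if "0 < s" for s
      using that by (cases "t \<le> s") (smt (verit))+
    thus ?thesis using ct by blast
  qed
  then obtain c t where ct: "0 < c" "0 < t" and
    le: "\<And>s. 0 < s \<Longrightarrow> layer_prob M X p s \<le>
      layer_prob std_exponential (\<lambda>u. c * u) p s + layer_prob M (\<lambda>_. t) p s" by blast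
  note [measurable] = borel_measurable_layer_prob[of "\<lambda>_. t"]
    E.borel_measurable_layer_prob[of "\<lambda>u. c * u"]
  let ?L = "\<lambda>l s. ennreal (indicator {0<..} s * (\<bar>p\<bar> * s powr (p - 1) * l s))"
  have "(\<integral>\<^sup>+x. ennreal (X x powr p) \<partial>M) = (\<integral>\<^sup>+s. ?L (layer_prob M X p) s \<partial>lborel)"
    using False X_pos by (intro nn_moment_layer_cake) auto
  also have "\<dots> \<le> (\<integral>\<^sup>+s. ?L (layer_prob std_exponential (\<lambda>u. c * u) p) s + ?L (layer_prob M (\<lambda>_. t) p) s \<partial>lborel)"
  proof (intro nn_integral_mono)
    fix s :: real
    show "?L (layer_prob M X p) s \<le> ?L (layer_prob std_exponential (\<lambda>u. c * u) p) s + ?L (layer_prob M (\<lambda>_. t) p) s"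
    proof (cases "s > 0")
      case True
      have "\<bar>p\<bar> * s powr (p - 1) * layer_prob M X p s \<le> \<bar>p\<bar> * s powr (p - 1) *
          (layer_prob std_exponential (\<lambda>u. c * u) p s + layer_prob M (\<lambda>_. t) p s)"
        by (intro mult_left_mono le True) auto
      hence "ennreal (\<bar>p\<bar> * s powr (p - 1) * layer_prob M X p s) \<le>
          ennreal (\<bar>p\<bar> * s powr (p - 1) * layer_prob std_exponential (\<lambda>u. c * u) p s +
            \<bar>p\<bar> * s powr (p - 1) * layer_prob M (\<lambda>_. t) p s)"
        by (intro ennreal_leI) (simp only: distrib_left)
      also have "\<dots> = ennreal (\<bar>p\<bar> * s powr (p - 1) * layer_prob std_exponential (\<lambda>u. c * u) p s) +
            ennreal (\<bar>p\<bar> * s powr (p - 1) * layer_prob M (\<lambda>_. t) p s)"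
        by (intro ennreal_plus) (auto simp: layer_prob_def)
      finally show ?thesis using True by simp
    qed auto
  qed
  also have "\<dots> = (\<integral>\<^sup>+s. ?L (layer_prob std_exponential (\<lambda>u. c * u) p) s \<partial>lborel) +
      (\<integral>\<^sup>+s. ?L (layer_prob M (\<lambda>_. t) p) s \<partial>lborel)"
    by (rule nn_integral_add) measurable
  also have "(\<integral>\<^sup>+s. ?L (layer_prob M (\<lambda>_. t) p) s \<partial>lborel) = (\<integral>\<^sup>+x. ennreal (t powr p) \<partial>M)"
    using False ct by (intro nn_moment_layer_cake[symmetric]) auto
  also have "\<dots> = ennreal (t powr p)" by (simp add: emeasure_space_1)
  also have "(\<integral>\<^sup>+s. ?L (layer_prob std_exponential (\<lambda>u. c * u) p) s \<partial>lborel) =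
      (\<integral>\<^sup>+u. ennreal ((c * u) powr p) \<partial>std_exponential)"
    using False ct AE_std_exponential_pos by (intro E.nn_moment_layer_cake[symmetric]) auto
  also have "\<dots> = ennreal (c powr p * Gamma (1 + p))"
    using ct(1) p by (rule nn_integral_std_exponential_powr)
  finally have "(\<integral>\<^sup>+x. ennreal (X x powr p) \<partial>M) < \<infinity>"
    by (rule le_less_trans) simp
  thus ?thesis by (simp add: integrable_iff_bounded)
qed simp

lemma expectation_powr_pos:
  assumes "-1 < p"
  shows "0 < expectation (\<lambda>x. X x powr p)"
proof -
  have "\<not> (AE x in M. X x powr p = 0)"
    using AE_False by simp
  thus ?thesis
    using integral_nonneg_eq_0_iff_AE[OF integrable_moment[OF assms]]
      integral_nonneg_AE[of "\<lambda>x. X x powr p" M] by (simp add: less_le)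
qed

lemma gamma_mean_pos:
  assumes "-1 < p"
  shows "0 < gamma_mean p"
proof -
  have "0 < Gamma (1 + p)" using assms by (intro Gamma_real_pos) simp
  thus ?thesis using expectation_powr_pos[OF assms] by (simp add: gamma_mean_def)
qed

text \<open>For \<open>p < 0\<close> the power \<open>1 / p\<close> reverses the order and the
  division by \<open>p\<close> reverses it back. The resulting quantity is the one compared in
  \<open>moment_single_crossing\<close>.\<close>

lemma gamma_mean_le_iff:
  assumes "-1 < p" "p \<noteq> 0" "0 < c"
  shows "gamma_mean p \<le> c \<longleftrightarrow> (expectation (\<lambda>x. X x powr p) - c powr p * Gamma (1 + p)) / p \<le> 0"
proof -
  define Y where "Y = expectation (\<lambda>x. X x powr p) / Gamma (1 + p)"
  have g: "Gamma (1 + p) > 0" using assms by (intro Gamma_real_pos) simp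
  have Y: "Y > 0" using expectation_powr_pos[OF assms(1)] g by (simp add: Y_def)
  have "gamma_mean p \<le> c \<longleftrightarrow> ln (Y powr (1 / p)) \<le> ln c"
    using Y assms by (subst ln_le_cancel_iff) (auto simp: gamma_mean_def Y_def)
  also have "\<dots> \<longleftrightarrow> (ln Y - ln (c powr p)) / p \<le> 0"
    using Y assms by (simp add: ln_powr diff_divide_distrib)
  also have "\<dots> \<longleftrightarrow> (Y - c powr p) / p \<le> 0"
  proof -
    have "ln Y \<le> ln (c powr p) \<longleftrightarrow> Y \<le> c powr p" "ln (c powr p) \<le> ln Y \<longleftrightarrow> c powr p \<le> Y"
      using Y assms by (auto simp del: ln_powr)
    thus ?thesis by (simp add: divide_le_0_iff del: ln_powr)
  qed
  also have "\<dots> \<longleftrightarrow> (expectation (\<lambda>x. X x powr p) - c powr p * Gamma (1 + p)) / p \<le> 0"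
  proof -
    have "expectation (\<lambda>x. X x powr p) = Gamma (1 + p) * Y" using g by (simp add: Y_def)
    hence eq: "(expectation (\<lambda>x. X x powr p) - c powr p * Gamma (1 + p)) / p = Gamma (1 + p) * ((Y - c powr p) / p)"
      by (simp add: right_diff_distrib)
    show ?thesis unfolding eq
      using mult_le_cancel_left_pos[OF g, of "(Y - c powr p) / p" 0] by (simp only: mult_zero_right)
  qed
  finally show ?thesis .
qed

lemma gamma_mean_antimono:
  assumes pq: "-1 < p" "p < q" "p \<noteq> 0" "q \<noteq> 0"
  shows "gamma_mean q \<le> gamma_mean p"
proof (rule dense_ge)
  fix c assume c: "gamma_mean p < c"
  hence c0: "0 < c" using gamma_mean_pos[of p] pq by linarith
  define J where "J p = (expectation (\<lambda>x. X x powr p) - (\<integral>t. (c * t) powr p \<partial>std_exponential)) / p" for p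
  have Jp: "J r \<le> 0 \<longleftrightarrow> gamma_mean r \<le> c" if "-1 < r" "r \<noteq> 0" for r
    using gamma_mean_le_iff[OF that c0] that c0 by (simp add: J_def std_exponential_powr)
  define S where "S = {s. 0 < s \<and> tail s < exp (- s / c)}"
  have pos: "AE t in std_exponential. 0 < c * t" using AE_std_exponential_pos c0 by auto
  \<comment> \<open>Here the strict inequality \<open>gamma_mean p < c\<close> is used: it makes
    \<open>J p\<close> negative, whereas a tail that never falls below the exponential one would
    make \<open>J p\<close> nonnegative.\<close>
  have "S \<noteq> {}"
  proof
    assume "S = {}"
    have ge: "tail s \<ge> exp (- s / c)" if "0 < s" for s
    proof -
      have "s \<notin> S" using \<open>S = {}\<close> by simp
      thus ?thesis using that by (simp add: S_def not_less)
    qed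
    have h: "has_bochner_integral lborel
      (\<lambda>s. indicator {0<..} s * (s powr (p - 1) * (\<P>(x in M. s < X x) - \<P>(t in std_exponential. s < c * t)))) (J p)"
      unfolding J_def by (rule moment_diff)
        (use prob_space_axioms prob_space_std_exponential X_pos pos pq c0 integrable_moment std_exponential_powr(1) in auto)
    have "0 \<le> J p"
      unfolding has_bochner_integral_integral_eq[OF h, symmetric]
    proof (rule integral_nonneg_AE, intro AE_I2)
      fix s :: real
      show "0 \<le> indicator {0<..} s * (s powr (p - 1) * (\<P>(x in M. s < X x) - \<P>(t in std_exponential. s < c * t)))"
        using ge[of s] c0 by (auto simp: indicator_def std_exponential_tail tail_def[symmetric])
    qed
    moreover have "J p \<noteq> 0"
    proof
      assume "J p = 0"
      hence "expectation (\<lambda>x. X x powr p) = c powr p * Gamma (1 + p)"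
        using pq c0 by (simp add: J_def std_exponential_powr)
      moreover have "Gamma (1 + p) \<noteq> 0" using pq Gamma_real_pos[of "1 + p"] by linarith
      ultimately have "gamma_mean p = c"
        using pq c0 by (simp add: gamma_mean_def powr_powr)
      thus False using c by simp
    qed
    moreover have "J p \<le> 0" using Jp[of p] c pq by simp
    ultimately show False by simp
  qed
  \<comment> \<open>The crossing point: nothing below it lies in \<open>S\<close>, and by
    \<open>tail_less_exp\<close> everything above it does. It is 0 if the tail is below the
    exponential one from the start.\<close>
  define s0 where "s0 = Inf S"
  have bdd: "bdd_below S" by (auto simp: S_def intro!: bdd_belowI[of _ 0])
  have s0: "0 \<le> s0" unfolding s0_def using \<open>S \<noteq> {}\<close> by (intro cInf_greatest) (auto simp: S_def)
  have "J q \<le> s0 powr (q - p) * J p"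
    unfolding J_def
  proof (rule moment_single_crossing[where M = M and N = std_exponential])
    fix s assume s: "0 < s" "s < s0"
    hence "s \<notin> S" using cInf_lower[OF _ bdd, of s] by (auto simp: s0_def)
    thus "\<P>(t in std_exponential. s < c * t) \<le> \<P>(x in M. s < X x)"
      using s c0 by (auto simp: S_def tail_def std_exponential_tail)
  next
    fix s assume s: "s0 < s"
    then obtain t where "t \<in> S" "t < s"
      using cInf_less_iff[OF \<open>S \<noteq> {}\<close> bdd] by (auto simp: s0_def)
    hence "tail s < exp (- s / c)" using tail_less_exp[of c t s] c0 by (auto simp: S_def)
    thus "\<P>(x in M. s < X x) \<le> \<P>(t in std_exponential. s < c * t)"
      using s s0 c0 by (simp add: tail_def std_exponential_tail)
  qed (use prob_space_axioms prob_space_std_exponential X_pos pos pq c0 s0 integrable_moment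
        std_exponential_powr(1) in auto)
  also have "\<dots> \<le> 0"
    using Jp[of p] c pq by (intro mult_nonneg_nonpos) auto
  finally show "gamma_mean q \<le> c" using Jp[of q] pq by simp
qed

section \<open>The limit of the normalised means at exponent 0\<close>

lemma DERIV_moment_0:
  "((\<lambda>p. expectation (\<lambda>x. X x powr p)) has_real_derivative expectation (\<lambda>x. ln (X x))) (at 0)"
proof -
  \<comment> \<open>The interval confines the exponents to the range of
    \<open>abs_powr_diff_quotient_le\<close>; as 0 is an interior point, the limit does not change.
    It is then tested along sequences in order to apply dominated convergence.\<close>
  have at0: "at (0::real) = at 0 within {-1/2..1/2}"
    by (rule at_within_interior[symmetric]) auto
  have "((\<lambda>p. expectation (\<lambda>x. (X x powr p - 1) / p)) \<longlongrightarrow> expectation (\<lambda>x. ln (X x))) (at 0)"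
    unfolding at0 tendsto_at_iff_sequentially comp_def
  proof (intro allI impI)
    fix P :: "nat \<Rightarrow> real"
    assume P: "\<forall>i. P i \<in> {-1/2..1/2} - {0}" and lim: "P \<longlonglongrightarrow> 0"
    show "(\<lambda>n. expectation (\<lambda>x. (X x powr P n - 1) / P n)) \<longlonglongrightarrow> expectation (\<lambda>x. ln (X x))"
    proof (rule integral_dominated_convergence)
      show "integrable M (\<lambda>x. 2 * (X x powr (1/2) + X x powr (- 1/2)))"
        by (intro integrable_mult_right Bochner_Integration.integrable_add integrable_moment) auto
      show "AE x in M. norm ((X x powr P n - 1) / P n) \<le> 2 * (X x powr (1/2) + X x powr (- 1/2))" for n
        unfolding real_norm_def
      proof (intro AE_I2 abs_powr_diff_quotient_le X_pos)
        show "P n \<noteq> 0" "\<bar>P n\<bar> \<le> 1 / 2" using P by (auto simp: abs_le_iff dest: spec[of _ n])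
      qed
      show "AE x in M. (\<lambda>n. (X x powr P n - 1) / P n) \<longlonglongrightarrow> ln (X x)"
      proof (rule AE_I2)
        fix x
        have "((\<lambda>p. X x powr p) has_real_derivative ln (X x)) (at 0)"
          using X_pos[of x] by (auto intro!: derivative_eq_intros)
        hence "((\<lambda>p. (X x powr p - 1) / p) \<longlongrightarrow> ln (X x)) (at 0)"
          using X_pos[of x] by (simp add: has_field_derivative_iff)
        moreover have "filterlim P (at 0) sequentially"
          using lim P by (auto simp: filterlim_at)
        ultimately show "(\<lambda>n. (X x powr P n - 1) / P n) \<longlonglongrightarrow> ln (X x)"
          by (rule filterlim_compose)
      qed
    qed measurable
  qed
  moreover have "\<forall>\<^sub>F p in at 0. expectation (\<lambda>x. (X x powr p - 1) / p) =
      (expectation (\<lambda>x. X x powr p) - expectation (\<lambda>x. X x powr 0)) / (p - 0)"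
  proof -
    have "\<forall>\<^sub>F p in at (0::real). -1 < p" by (rule order_tendstoD[OF tendsto_ident_at]) simp
    thus ?thesis
    proof eventually_elim
      case (elim p)
      thus ?case using integrable_moment[of p] by (simp add: prob_space)
    qed
  qed
  ultimately show ?thesis unfolding has_field_derivative_iff
    by (rule Lim_transform_eventually)
qed

text \<open>The logarithm of \<open>gamma_mean p\<close> is \<open>?g p / p\<close> with
  \<open>?g 0 = 0\<close>, a difference quotient of \<open>?g\<close> at 0. So the limit is
  \<open>exp\<close> of the derivative of \<open>?g\<close> there, in particular positive.\<close>

lemma gamma_mean_tendsto_0:
  obtains m where "0 < m" "(gamma_mean \<longlongrightarrow> m) (at 0)"
proof -
  let ?E = "\<lambda>p. expectation (\<lambda>x. X x powr p)"
  let ?g = "\<lambda>p. ln (?E p) - ln (Gamma (1 + p))"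
  have E0: "?E 0 = 1" by (simp add: prob_space)
  have "((\<lambda>p. Gamma (1 + p)) has_real_derivative Digamma 1) (at 0)"
    by (auto intro!: derivative_eq_intros)
  hence "(?g has_real_derivative expectation (\<lambda>x. ln (X x)) - Digamma 1) (at 0)"
    by (auto intro!: derivative_eq_intros DERIV_moment_0 simp: E0 prob_space)
  hence "((\<lambda>p. ?g p / p) \<longlongrightarrow> expectation (\<lambda>x. ln (X x)) - Digamma 1) (at 0)"
    by (simp add: has_field_derivative_iff E0 prob_space)
  hence "((\<lambda>p. exp (?g p / p)) \<longlongrightarrow> exp (expectation (\<lambda>x. ln (X x)) - Digamma 1)) (at 0)"
    by (rule tendsto_exp)
  moreover have "\<forall>\<^sub>F p in at 0. exp (?g p / p) = gamma_mean p"
  proof -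
    have "\<forall>\<^sub>F p in at (0::real). -1 < p" by (rule order_tendstoD[OF tendsto_ident_at]) simp
    thus ?thesis
    proof eventually_elim
      case (elim p)
      have "Gamma (1 + p) > 0" using elim by (intro Gamma_real_pos) simp
      moreover from this have "Gamma (1 + p) \<noteq> 0" by linarith
      ultimately show ?case using elim expectation_powr_pos[of p]
        by (simp add: gamma_mean_def powr_def ln_div)
    qed
  qed
  ultimately have "(gamma_mean \<longlongrightarrow> exp (expectation (\<lambda>x. ln (X x)) - Digamma 1)) (at 0)"
    by (simp add: tendsto_cong)
  thus ?thesis by (intro that) auto
qed

end

subsection \<open>Log-concave functions and their epigraphs\<close>

lemma log_concave_nonneg: "log_concave f \<Longrightarrow> 0 \<le> f x"
  by (simp add: log_concave_def)

lemma log_concave_convex_comb: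
  assumes "log_concave f" "0 < l" "l < 1"
  shows "f x powr l * f y powr (1 - l) \<le> f (l *\<^sub>R x + (1 - l) *\<^sub>R y)"
  using assms by (simp add: log_concave_def)

lemma convex_log_concave_superlevel:
  assumes f: "log_concave f" and c: "0 < c"
  shows "convex {x. c < f x}"
proof (rule convexI)
  fix x y u v assume xy: "x \<in> {x. c < f x}" "y \<in> {x. c < f x}" and uv: "0 \<le> u" "0 \<le> v" "u + v = (1::real)"
  consider "u = 0" "v = 1" | "u = 1" "v = 0" | "0 < u" "u < 1" using uv by linarith
  thus "u *\<^sub>R x + v *\<^sub>R y \<in> {x. c < f x}"
  proof cases
    case 3
    have "c = c powr u * c powr (1 - u)" using c by (simp add: powr_add[symmetric])
    also have "\<dots> < f x powr u * f y powr (1 - u)"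
      using xy 3 c by (intro mult_strict_mono powr_less_mono2) auto
    also have "\<dots> \<le> f (u *\<^sub>R x + (1 - u) *\<^sub>R y)"
      using f 3 by (rule log_concave_convex_comb)
    finally show ?thesis using uv by (simp add: eq_diff_eq[symmetric] add.commute)
  qed (use xy in auto)
qed

text \<open>A convex set with empty interior is negligible. If this held for all superlevel sets at
  the levels \<open>1 / real (Suc n)\<close>, then \<open>f\<close> would vanish almost
  everywhere.\<close>

lemma log_concave_gt_on_ball:
  fixes f :: "'a::euclidean_space \<Rightarrow> real"
  assumes f: "log_concave f" and pos: "(LINT x|lebesgue. f x) > 0"
  obtains c x0 r where "0 < c" "0 < r" "ball x0 r \<subseteq> {x. c < f x}"
proof -
  have "\<exists>n. interior {x. 1 / real (Suc n) < f x} \<noteq> {}"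
  proof (rule ccontr)
    assume "\<nexists>n. interior {x. 1 / real (Suc n) < f x} \<noteq> {}"
    hence "negligible {x. 1 / real (Suc n) < f x}" for n
      by (subst negligible_convex_interior) (auto intro!: convex_log_concave_superlevel f)
    hence "negligible (\<Union>n. {x. 1 / real (Suc n) < f x})"
      by (intro negligible_countable_Union) auto
    hence "AE x in lebesgue. x \<notin> (\<Union>n. {x. 1 / real (Suc n) < f x})"
      unfolding negligible_iff_null_sets by (rule AE_not_in)
    hence "AE x in lebesgue. f x = 0"
    proof eventually_elim
      case (elim x)
      show ?case
      proof (rule ccontr)
        assume "f x \<noteq> 0"
        hence "0 < f x" using log_concave_nonneg[OF f, of x] by simp
        thus False using reals_Archimedean[of "f x"] elim by (auto simp: inverse_eq_divide)
      qed
    qed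
    hence "(LINT x|lebesgue. f x) = 0" by (rule integral_eq_zero_AE)
    thus False using pos by simp
  qed
  then obtain n x0 where "x0 \<in> interior {x. 1 / real (Suc n) < f x}" by blast
  then obtain r where "0 < r" "ball x0 r \<subseteq> {x. 1 / real (Suc n) < f x}"
    unfolding mem_interior by blast
  thus ?thesis by (intro that[of "1 / real (Suc n)" r x0]) auto
qed

text \<open>If \<open>f > c\<close> on a ball, then \<open>f \<ge> sqrt (c * f y)\<close> on the ball of half the radius around the
  midpoint, so a large value \<open>f y\<close> forces a large integral.\<close>

lemma log_concave_integrable_bdd_above:
  fixes f :: "'a::euclidean_space \<Rightarrow> real"
  assumes f: "log_concave f" and int: "integrable lebesgue f" and pos: "(LINT x|lebesgue. f x) > 0"
  shows "bdd_above (range f)"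
proof -
  obtain c x0 r where c: "0 < c" and r: "0 < r" and ball: "ball x0 r \<subseteq> {x. c < f x}"
    using log_concave_gt_on_ball[OF f pos] .
  define V where "V = measure lebesgue (ball (0::'a) (r / 2))"
  have V: "V > 0" using r by (simp add: V_def content_ball_pos)
  show ?thesis
  proof (rule bdd_aboveI2)
    fix y
    let ?m = "(1/2) *\<^sub>R y + (1/2) *\<^sub>R x0"
    define K where "K = f y powr (1/2) * c powr (1/2)"
    have le: "K * indicator (ball ?m (r / 2)) w \<le> f w" for w
    proof (cases "w \<in> ball ?m (r / 2)")
      case True
      \<comment> \<open>The reflection of \<open>y\<close> in \<open>w\<close>, so that
        \<open>w\<close> is the midpoint of \<open>y\<close> and \<open>z\<close>. It lies in the
        ball around \<open>x0\<close> because \<open>y\<close> reflected in \<open>?m\<close> is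
        \<open>x0\<close>, and reflecting doubles the distance between \<open>w\<close> and
        \<open>?m\<close>.\<close>
      define z where "z = 2 *\<^sub>R w - y"
      have w: "w = (1/2) *\<^sub>R y + (1 - 1/2) *\<^sub>R z" by (simp add: z_def algebra_simps)
      have "x0 - z = 2 *\<^sub>R (?m - w)" by (simp add: z_def algebra_simps)
      hence "dist x0 z = 2 * dist ?m w" unfolding dist_norm by simp
      hence "z \<in> ball x0 r" using True by simp
      hence "c < f z" using ball by auto
      hence "K \<le> f y powr (1/2) * f z powr (1 - 1/2)"
        unfolding K_def using c log_concave_nonneg[OF f] by (intro mult_left_mono) (auto intro!: powr_mono2)
      also have "\<dots> \<le> f w" unfolding w by (rule log_concave_convex_comb[OF f]) auto
      finally show ?thesis using True by simp
    qed (use log_concave_nonneg[OF f] in auto)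
    have "K * V = (LINT w|lebesgue. K * indicator (ball ?m (r / 2)) w)"
      using r by (simp add: V_def content_ball)
    also have "\<dots> \<le> (LINT w|lebesgue. f w)"
      using le int by (intro integral_mono) (auto simp: emeasure_lborel_ball_finite[unfolded infinity_ennreal_def])
    finally have "f y powr (1/2) \<le> (LINT w|lebesgue. f w) / (c powr (1/2) * V)"
      using V c by (simp add: K_def field_simps)
    hence "(f y powr (1/2)) powr 2 \<le> ((LINT w|lebesgue. f w) / (c powr (1/2) * V)) powr 2"
      by (intro powr_mono2) auto
    thus "f y \<le> ((LINT w|lebesgue. f w) / (c powr (1/2) * V)) powr 2"
      using log_concave_nonneg[OF f, of y] by (simp add: powr_powr)
  qed
qed

lemma convex_epi_L:
  assumes f: "log_concave f" and M: "0 < sup_norm f"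
  shows "convex (epi_L f)"
proof (rule convexI)
  fix z w and u v :: real
  assume zw: "z \<in> epi_L f" "w \<in> epi_L f" and uv: "0 \<le> u" "0 \<le> v" "u + v = 1"
  obtain x t y s where [simp]: "z = (x, t)" "w = (y, s)" by (cases z, cases w)
  consider "u = 0" "v = 1" | "u = 1" "v = 0" | "0 < u" "u < 1" "v = 1 - u" using uv by linarith
  thus "u *\<^sub>R z + v *\<^sub>R w \<in> epi_L f"
  proof cases
    case 3
    have "exp (- (u * t + v * s)) * sup_norm f
        = (exp (- t) * sup_norm f) powr u * (exp (- s) * sup_norm f) powr (1 - u)"
    proof -
      have "sup_norm f = sup_norm f powr u * sup_norm f powr (1 - u)"
        using M by (simp add: powr_add[symmetric])
      moreover have "exp (- (u * t + v * s)) = exp (- t) powr u * exp (- s) powr (1 - u)"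
        using 3 by (simp add: powr_def exp_add[symmetric])
      ultimately show ?thesis using M by (simp add: powr_mult)
    qed
    also have "\<dots> \<le> f x powr u * f y powr (1 - u)"
      using zw 3 M by (intro mult_mono powr_mono2) (auto simp: epi_L_def)
    also have "\<dots> \<le> f (u *\<^sub>R x + (1 - u) *\<^sub>R y)"
      using f 3(1,2) by (rule log_concave_convex_comb)
    finally show ?thesis using 3 by (simp add: epi_L_def)
  qed (use zw in auto)
qed

text \<open>The boundary of a convex set is a null set. This matters because a concave function is
  continuous on the interior but may fail to be measurable on the boundary, hence the arbitrary
  \<open>F\<close>.\<close>

lemma set_nn_integral_convex_interior:
  fixes L :: "'a::euclidean_space set"
  assumes "convex L"
  shows "(\<integral>\<^sup>+z\<in>L. F z \<partial>lebesgue) = (\<integral>\<^sup>+z\<in>interior L. F z \<partial>lborel)"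
proof -
  have "frontier L \<in> null_sets lebesgue"
    using negligible_convex_frontier[OF assms] by (simp add: negligible_iff_null_sets)
  hence "AE z in lebesgue. z \<notin> frontier L" by (rule AE_not_in)
  hence "(\<integral>\<^sup>+z\<in>L. F z \<partial>lebesgue) = (\<integral>\<^sup>+z\<in>interior L. F z \<partial>lebesgue)"
  proof (intro nn_integral_cong_AE, eventually_elim)
    case (elim z)
    thus ?case using interior_subset[of L] closure_subset[of L]
      by (auto simp: frontier_def indicator_def)
  qed
  thus ?thesis by (simp add: nn_integral_completion)
qed

text \<open>For \<open>a = f x\<close> and \<open>M = sup_norm f\<close> this is the section of
  \<open>epi_L f\<close> over \<open>x\<close>: a half-line starting at \<open>- ln (a / M)\<close>,
  or empty if \<open>a = 0\<close>. Through it the mass of the epigraph is controlled by the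
  integral of \<open>f\<close>.\<close>

lemma nn_integral_exp_epi_section:
  assumes "0 \<le> a" "0 < M"
  shows "(\<integral>\<^sup>+t. ennreal (exp (- t)) * indicator {t. exp (- t) * M \<le> a} t \<partial>lborel) = ennreal (a / M)"
proof (cases "a = 0")
  case True
  have "{t. exp (- t) * M \<le> a} = {}" using True assms by (auto simp: not_le)
  thus ?thesis using True by simp
next
  case False
  hence a: "0 < a" using assms by simp
  define b where "b = - ln (a / M)"
  have b: "exp (- b) = a / M" using a assms by (simp add: b_def)
  have "exp (- t) * M \<le> a \<longleftrightarrow> exp (- t) \<le> exp (- b)" for t
    unfolding b using assms by (simp add: pos_le_divide_eq)
  hence "{t. exp (- t) * M \<le> a} = {b..}" by auto
  moreover have "((\<lambda>t. exp (- t)) has_integral (a / M)) {b..}"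
    using has_integral_exp_minus_to_infinity[of 1 b] b by simp
  hence "(\<integral>\<^sup>+t. ennreal (exp (- t)) * indicator {b..} t \<partial>lborel) = ennreal (a / M)"
    by (rule nn_integral_has_integral_lebesgue'[rotated]) simp
  ultimately show ?thesis by simp
qed

lemma nn_integral_epi_interior_finite:
  fixes f :: "'a::euclidean_space \<Rightarrow> real"
  assumes f: "\<And>x. 0 \<le> f x" and int: "integrable lebesgue f" and M: "0 < sup_norm f"
  shows "(\<integral>\<^sup>+z\<in>interior (epi_L f). ennreal (exp (- snd z)) \<partial>lborel) < \<infinity>"
proof -
  let ?U = "interior (epi_L f)"
  have [measurable]: "?U \<in> sets borel" by simp
  have [measurable]: "(snd :: 'a \<times> real \<Rightarrow> real) \<in> borel_measurable borel"
    by (intro borel_measurable_continuous_onI continuous_intros)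
  have [measurable]: "(\<lambda>z. ennreal (exp (- snd z)) * indicator ?U z) \<in>
     borel_measurable (lborel \<Otimes>\<^sub>M (lborel :: real measure))"
    unfolding lborel_prod measurable_lborel1 by measurable
  have "(\<integral>\<^sup>+z\<in>?U. ennreal (exp (- snd z)) \<partial>lborel) =
      (\<integral>\<^sup>+x. \<integral>\<^sup>+t. ennreal (exp (- t)) * indicator ?U (x, t) \<partial>lborel \<partial>lborel)"
    by (subst lborel_prod[symmetric], subst lborel.nn_integral_fst[symmetric]) auto
  also have "\<dots> \<le> (\<integral>\<^sup>+x. ennreal (f x / sup_norm f) \<partial>lborel)"
  proof (intro nn_integral_mono)
    fix x
    have "(\<integral>\<^sup>+t. ennreal (exp (- t)) * indicator ?U (x, t) \<partial>lborel) \<le>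
        (\<integral>\<^sup>+t. ennreal (exp (- t)) * indicator {t. exp (- t) * sup_norm f \<le> f x} t \<partial>lborel)"
      using interior_subset[of "epi_L f"]
      by (intro nn_integral_mono) (auto simp: indicator_def epi_L_def)
    thus "(\<integral>\<^sup>+t. ennreal (exp (- t)) * indicator ?U (x, t) \<partial>lborel) \<le> ennreal (f x / sup_norm f)"
      using nn_integral_exp_epi_section[OF f M, of x] by simp
  qed
  also have "\<dots> = (\<integral>\<^sup>+x. ennreal (f x / sup_norm f) \<partial>lebesgue)"
    by (simp add: nn_integral_completion)
  also have "\<dots> < \<infinity>"
    using integrableD(2)[OF integrable_divide_zero[OF int, of "sup_norm f"]] f M
    by (simp add: less_top)
  finally show ?thesis .
qed

lemma interior_epi_L_nonempty:
  fixes f :: "'a::euclidean_space \<Rightarrow> real"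
  assumes "0 < c" "0 < r" and ball: "ball x0 r \<subseteq> {x. c < f x}" and M: "0 < sup_norm f"
  shows "interior (epi_L f) \<noteq> {}"
proof -
  \<comment> \<open>From height \<open>T\<close> upwards the threshold
    \<open>exp (- t) * sup_norm f\<close> is at most \<open>c\<close>, so the cylinder above the
    ball lies in the epigraph.\<close>
  define T where "T = ln (sup_norm f / c)"
  have T: "exp (- T) * sup_norm f = c" using M assms(1) by (simp add: T_def exp_minus)
  have "ball x0 r \<times> {T<..} \<subseteq> epi_L f"
  proof
    fix z assume "z \<in> ball x0 r \<times> {T<..}"
    then obtain x t where z: "z = (x, t)" "x \<in> ball x0 r" "T < t"
      by (metis greaterThan_iff mem_Times_iff prod.collapse)
    have "exp (- t) * sup_norm f \<le> exp (- T) * sup_norm f"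
      using z M by (intro mult_right_mono) auto
    also have "\<dots> \<le> f x" unfolding T using z(2) ball by (auto dest!: subsetD)
    finally show "z \<in> epi_L f" by (simp add: z epi_L_def)
  qed
  hence "ball x0 r \<times> {T<..} \<subseteq> interior (epi_L f)"
    by (rule interior_maximal) (intro open_Times open_ball open_greaterThan)
  moreover have "(x0, T + 1) \<in> ball x0 r \<times> {T<..}" using assms(2) by simp
  ultimately show ?thesis by blast
qed

text \<open>Pairs on opposite sides of 0 are already covered by \<open>F\<close>. Only the
  comparisons with the value \<open>m\<close> at 0 need a limit, from the right for
  \<open>F q \<le> m\<close> and from the left for \<open>m \<le> F p\<close>.\<close>

lemma antimono_on_fun_upd_limit:
  fixes F :: "real \<Rightarrow> 'a::linorder_topology"
  assumes lim: "(F \<longlongrightarrow> m) (at 0)"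
    and F: "\<And>p q. a < p \<Longrightarrow> p < q \<Longrightarrow> p \<noteq> 0 \<Longrightarrow> q \<noteq> 0 \<Longrightarrow> F q \<le> F p" and a: "a < 0"
  shows "antimono_on {a<..} (F(0 := m))"
proof -
  have R: "F q \<le> m" if "0 < q" for q
  proof (rule tendsto_lowerbound)
    show "(F \<longlongrightarrow> m) (at_right 0)" using lim by (rule tendsto_within_subset) simp
    show "\<forall>\<^sub>F p in at_right 0. F q \<le> F p"
      using eventually_at_right_real[OF that]
    proof eventually_elim
      case (elim p)
      thus ?case using F[of p q] a that by simp
    qed
  qed simp
  have L: "m \<le> F p" if "a < p" "p < 0" for p
  proof (rule tendsto_upperbound)
    show "(F \<longlongrightarrow> m) (at_left 0)" using lim by (rule tendsto_within_subset) simp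
    show "\<forall>\<^sub>F q in at_left 0. F q \<le> F p"
      using eventually_at_left_real[OF that(2)]
    proof eventually_elim
      case (elim q)
      thus ?case using F[of p q] that by simp
    qed
  qed simp
  show ?thesis
  proof (rule monotone_onI)
    fix p q assume pq: "p \<in> {a<..}" "q \<in> {a<..}" "p \<le> q"
    show "(F(0 := m)) q \<le> (F(0 := m)) p"
      using pq R[of q] L[of p] F[of p q] by (cases "p = q") auto
  qed
qed

text \<open>A concave function cannot touch its minimum 0 inside an open set unless it is constant:
  the segment from any \<open>w\<close> to a zero \<open>z\<close> extends slightly beyond
  \<open>z\<close>, and concavity at \<open>z\<close> then forces
  \<open>h w \<le> 0\<close>.\<close>

lemma concave_on_open_nonneg_cases:
  fixes U :: "'a::real_normed_vector set"
  assumes "open U" "concave_on U h" and nonneg: "\<And>z. z \<in> U \<Longrightarrow> 0 \<le> h z"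
  obtains "\<And>z. z \<in> U \<Longrightarrow> 0 < h z" | "\<And>z. z \<in> U \<Longrightarrow> h z = 0"
proof (cases "\<forall>z\<in>U. 0 < h z")
  case False
  then obtain z where z: "z \<in> U" "h z = 0" using nonneg by (force simp: not_less)
  have "h w = 0" if w: "w \<in> U" for w
  proof -
    have "((\<lambda>e. z + e *\<^sub>R (z - w)) \<longlongrightarrow> z + 0 *\<^sub>R (z - w)) (at_right 0)"
      by (intro tendsto_intros)
    hence "\<forall>\<^sub>F e in at_right 0. z + e *\<^sub>R (z - w) \<in> U"
      using \<open>open U\<close> z by (intro topological_tendstoD) auto
    hence "\<forall>\<^sub>F e in at_right 0. z + e *\<^sub>R (z - w) \<in> U \<and> 0 < (e::real)"
      using eventually_at_right_less[of "0::real"] by eventually_elim simp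
    then obtain e where e: "z + e *\<^sub>R (z - w) \<in> U" "0 < e"
      using eventually_happens'[of "at_right (0::real)"] by auto
    \<comment> \<open>The weight of \<open>w\<close> that makes \<open>z\<close> the convex
      combination of \<open>w\<close> and \<open>z + e *\<^sub>R (z - w)\<close>.\<close>
    let ?l = "e / (1 + e)"
    have l: "0 < ?l" "?l < 1" using e by auto
    have "(1 + e) *\<^sub>R ((1 - ?l) *\<^sub>R (z + e *\<^sub>R (z - w)) + ?l *\<^sub>R w) = (1 + e) *\<^sub>R z"
    proof -
      have "(1 + e) * (1 - ?l) = 1" "(1 + e) * ?l = e" using e by (auto simp: field_simps)
      thus ?thesis by (simp only: scaleR_add_right[of "1 + e" "_ *\<^sub>R _"] scaleR_scaleR) (simp add: algebra_simps)
    qed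
    hence "(1 - ?l) *\<^sub>R (z + e *\<^sub>R (z - w)) + ?l *\<^sub>R w = z" using e by simp
    hence "(1 - ?l) * h (z + e *\<^sub>R (z - w)) + ?l * h w \<le> 0"
      using concave_onD[OF assms(2) _ _ e(1) w, of ?l] l z by simp
    moreover have "0 \<le> (1 - ?l) * h (z + e *\<^sub>R (z - w))" "0 \<le> h w"
      using l nonneg e w by auto
    ultimately have "?l * h w \<le> 0" by linarith
    hence "\<not> 0 < h w" using mult_pos_pos[OF l(1), of "h w"] by linarith
    thus ?thesis using \<open>0 \<le> h w\<close> by linarith
  qed
  thus ?thesis using that by blast
qed (use that in blast)

subsection \<open>Tails of concave functions on an epigraph\<close>

text \<open>Only these properties of the interior of the epigraph enter the probabilistic part;
  convexity of \<open>U\<close> is contained in \<open>concave_on U h\<close>.\<close>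

locale concave_on_epigraph =
  fixes U :: "('a::euclidean_space \<times> real) set" and h :: "'a \<times> real \<Rightarrow> real"
  assumes open_U: "open U" and nonempty: "U \<noteq> {}"
    and finite_mass: "(\<integral>\<^sup>+z\<in>U. ennreal (exp (- snd z)) \<partial>lborel) < \<infinity>"
    and concave: "concave_on U h"
    and h_pos: "\<And>z. z \<in> U \<Longrightarrow> 0 < h z"
begin

lemma borel_measurable_snd' [measurable]: "(snd :: 'a \<times> real \<Rightarrow> real) \<in> borel_measurable borel"
  by (intro borel_measurable_continuous_onI continuous_intros)

lemma U_measurable [measurable]: "U \<in> sets borel"
  using open_U by simp

definition mass :: real where
  "mass = enn2real (\<integral>\<^sup>+z\<in>U. ennreal (exp (- snd z)) \<partial>lborel)"

lemma nn_integral_mass: "(\<integral>\<^sup>+z\<in>U. ennreal (exp (- snd z)) \<partial>lborel) = ennreal mass"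
  unfolding mass_def using finite_mass by simp

lemma mass_pos: "0 < mass"
proof (rule ccontr)
  assume "\<not> 0 < mass"
  hence "(\<integral>\<^sup>+z\<in>U. ennreal (exp (- snd z)) \<partial>lborel) = 0"
    unfolding nn_integral_mass by (simp add: ennreal_neg)
  hence "AE z in lborel. ennreal (exp (- snd z)) * indicator U z = 0"
    by (subst (asm) nn_integral_0_iff_AE) auto
  hence "AE z in lborel. z \<notin> U" by eventually_elim (auto simp: indicator_def split: if_splits)
  hence "U \<in> null_sets lborel" by (simp add: AE_iff_null_sets)
  hence "negligible U" by (simp add: negligible_iff_null_sets null_sets_completionI)
  thus False using open_not_negligible[OF open_U nonempty] by simp
qed

definition P :: "('a \<times> real) measure" where
  "P = density lborel (\<lambda>z. ennreal (indicator U z * exp (- snd z) / mass))"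

text \<open>The value 1 outside \<open>U\<close> makes \<open>X\<close> positive everywhere, as
  \<open>log_star_tail\<close> demands. It does not affect any moment or tail, because
  \<open>P\<close> has no mass there.\<close>

definition X :: "'a \<times> real \<Rightarrow> real" where
  "X z = (if z \<in> U then h z else 1)"

lemma X_measurable [measurable]: "X \<in> borel_measurable borel"
proof -
  have "continuous_on U h"
    using convex_on_continuous[OF open_U concave[unfolded concave_on_def]] continuous_on_minus by fastforce
  thus ?thesis unfolding X_def
    by (intro borel_measurable_continuous_on_if) auto
qed

lemma sets_P [measurable_cong, simp]: "sets P = sets borel" and space_P [simp]: "space P = UNIV"
  by (simp_all add: P_def)

lemma nn_integral_P:
  assumes "F \<in> borel_measurable borel"
  shows "(\<integral>\<^sup>+z. F z \<partial>P) = (\<integral>\<^sup>+z\<in>U. F z * ennreal (exp (- snd z)) \<partial>lborel) / ennreal mass"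
proof -
  have "(\<integral>\<^sup>+z. F z \<partial>P) = (\<integral>\<^sup>+z. ennreal (indicator U z * exp (- snd z) / mass) * F z \<partial>lborel)"
    unfolding P_def using assms by (intro nn_integral_density) auto
  also have "\<dots> = (\<integral>\<^sup>+z. (F z * ennreal (exp (- snd z)) * indicator U z) / ennreal mass \<partial>lborel)"
    using mass_pos
    by (intro nn_integral_cong) (auto simp: indicator_def divide_ennreal[symmetric] ennreal_times_divide mult.commute)
  also have "\<dots> = (\<integral>\<^sup>+z\<in>U. F z * ennreal (exp (- snd z)) \<partial>lborel) / ennreal mass"
    using assms by (intro nn_integral_divide) auto
  finally show ?thesis .
qed

lemma prob_space_P: "prob_space P"
proof
  have "emeasure P (space P) = (\<integral>\<^sup>+z. 1 \<partial>P)" by simp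
  also have "\<dots> = 1"
    using mass_pos by (subst nn_integral_P) (auto simp: nn_integral_mass divide_ennreal)
  finally show "emeasure P (space P) = 1" .
qed

lemma nn_integral_superlevel_le:
  "(\<integral>\<^sup>+z. ennreal (indicator {z\<in>U. s < X z} z * exp (- snd z)) \<partial>lborel) \<le> ennreal mass"
  unfolding nn_integral_mass[symmetric] by (intro nn_integral_mono) (auto simp: indicator_def)

lemma tail_P:
  "\<P>(z in P. s < X z) =
     enn2real (\<integral>\<^sup>+z. ennreal (indicator {z\<in>U. s < X z} z * exp (- snd z)) \<partial>lborel) / mass"
proof -
  have "emeasure P {z. s < X z} = (\<integral>\<^sup>+z. indicator {z. s < X z} z \<partial>P)" by simp
  also have "\<dots> = (\<integral>\<^sup>+z\<in>U. indicator {z. s < X z} z * ennreal (exp (- snd z)) \<partial>lborel) / ennreal mass"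
    by (intro nn_integral_P) auto
  also have "(\<integral>\<^sup>+z\<in>U. indicator {z. s < X z} z * ennreal (exp (- snd z)) \<partial>lborel) =
      (\<integral>\<^sup>+z. ennreal (indicator {z\<in>U. s < X z} z * exp (- snd z)) \<partial>lborel)"
    by (intro nn_integral_cong) (auto simp: indicator_def)
  finally have "emeasure P {z. s < X z} = \<dots> / ennreal mass" .
  moreover obtain r where "(\<integral>\<^sup>+z. ennreal (indicator {z\<in>U. s < X z} z * exp (- snd z)) \<partial>lborel) = ennreal r" "0 \<le> r"
    using le_less_trans[OF nn_integral_superlevel_le[of s] ennreal_less_top] unfolding less_top_ennreal by blast
  ultimately show ?thesis using mass_pos by (simp add: measure_def divide_ennreal)
qed

text \<open>This is where Prekopa-Leindler enters: by concavity, \<open>l * {s < h} + (1 - l) * U\<close> is contained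
  in \<open>{l * s < h}\<close>.\<close>

sublocale log_star_tail P X
proof (intro log_star_tail.intro prob_space_P log_star_tail_axioms.intro)
  show "X \<in> borel_measurable P" by simp
  show "0 < X z" for z using h_pos by (simp add: X_def)
  fix l s :: real assume l: "0 < l" "l < 1" and s: "0 < s"
  let ?w = "\<lambda>s z. indicator {z\<in>U. s < X z} z * exp (- snd z)"
  let ?W = "\<lambda>s. \<integral>\<^sup>+z. ennreal (?w s z) \<partial>lborel"
  have "ennreal (enn2real (?W s) powr l *
      enn2real (\<integral>\<^sup>+z. ennreal (indicator U z * exp (- snd z)) \<partial>lborel) powr (1 - l)) \<le> ?W (l * s)"
  proof (rule prekopa_leindler)
    fix z w
    show "ennreal (?w s z powr l * (indicator U w * exp (- snd w)) powr (1 - l))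
        \<le> ennreal (?w (l * s) (l *\<^sub>R z + (1 - l) *\<^sub>R w))"
    proof (cases "z \<in> U \<and> s < X z \<and> w \<in> U")
      case True
      have "l * s < l * h z" "0 < (1 - l) * h w"
        using True l h_pos[of w] by (auto simp: X_def)
      hence "l * s < l * h z + (1 - l) * h w" by linarith
      also have "\<dots> \<le> h (l *\<^sub>R z + (1 - l) *\<^sub>R w)"
        using concave_onD[OF concave, of "1 - l" z w] True l by simp
      finally have "l * s < h (l *\<^sub>R z + (1 - l) *\<^sub>R w)" .
      moreover have "l *\<^sub>R z + (1 - l) *\<^sub>R w \<in> U"
        using concave_on_imp_convex[OF concave] True l by (intro convexD) auto
      moreover have "exp (- snd z) powr l * exp (- snd w) powr (1 - l) = exp (- snd (l *\<^sub>R z + (1 - l) *\<^sub>R w))"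
        by (simp add: powr_def exp_add[symmetric] algebra_simps)
      ultimately have "?w s z powr l * (indicator U w * exp (- snd w)) powr (1 - l) =
          ?w (l * s) (l *\<^sub>R z + (1 - l) *\<^sub>R w)"
        using True by (auto simp: X_def)
      thus ?thesis by simp
    qed (use l in auto)
  qed (use l in \<open>auto intro!: mult_nonneg_nonneg\<close>)
  also have "(\<integral>\<^sup>+z. ennreal (indicator U z * exp (- snd z)) \<partial>lborel) = ennreal mass"
    unfolding nn_integral_mass[symmetric] by (intro nn_integral_cong) (auto simp: indicator_def)
  finally have "ennreal (enn2real (?W s) powr l * mass powr (1 - l)) \<le> ?W (l * s)"
    using mass_pos by simp
  from enn2real_mono[OF this le_less_trans[OF nn_integral_superlevel_le ennreal_less_top]]
  have "enn2real (?W s) powr l * mass powr (1 - l) \<le> enn2real (?W (l * s))"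
    by simp
  \<comment> \<open>Since \<open>mass powr (1 - l) / mass = mass powr (- l)\<close>, this division
    normalises both sides to probabilities.\<close>
  hence "enn2real (?W s) powr l * mass powr (1 - l) / mass \<le> enn2real (?W (l * s)) / mass"
    using mass_pos by (intro divide_right_mono) auto
  also have "enn2real (?W s) powr l * mass powr (1 - l) / mass = (enn2real (?W s) / mass) powr l"
    using mass_pos by (simp add: powr_divide powr_diff)
  finally show "\<P>(z in P. s < X z) powr l \<le> \<P>(z in P. l * s < X z)"
    by (simp only: tail_P)
qed

lemma set_nn_integral_h_powr:
  assumes "-1 < p"
  shows "(\<integral>\<^sup>+z\<in>U. ennreal (h z powr p) * ennreal (exp (- snd z)) \<partial>lborel) =
    ennreal (expectation (\<lambda>z. X z powr p) * mass)"
proof -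
  have "(\<integral>\<^sup>+z\<in>U. ennreal (h z powr p) * ennreal (exp (- snd z)) \<partial>lborel) =
      (\<integral>\<^sup>+z\<in>U. ennreal (X z powr p) * ennreal (exp (- snd z)) \<partial>lborel)"
    by (intro nn_integral_cong) (auto simp: X_def indicator_def)
  also have "\<dots> = (\<integral>\<^sup>+z. ennreal (X z powr p) \<partial>P) * ennreal mass"
    using mass_pos by (subst nn_integral_P) (auto simp: ennreal_divide_times ennreal_mult_divide_eq)
  also have "(\<integral>\<^sup>+z. ennreal (X z powr p) \<partial>P) = ennreal (expectation (\<lambda>z. X z powr p))"
    using integrable_moment[OF assms] by (intro nn_integral_eq_integral) auto
  finally show ?thesis using mass_pos by (simp add: ennreal_mult'')
qed

end

section \<open>Assembly of the positive case, the vanishing case and the value at exponent 0\<close>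

theorem theorem1p1:
  fixes f :: "real ^ 'n \<Rightarrow> real"
    and h :: "(real ^ 'n) \<times> real \<Rightarrow> real"
  assumes "log_concave f"
    and "integrable lebesgue f"
    and "(LINT x|lebesgue. f x) > 0"
    and "concave_on (epi_L f) h"
    and "\<And>z. z \<in> epi_L f \<Longrightarrow> 0 \<le> h z"
  shows "\<exists>m0. (berwald_mean f h \<longlongrightarrow> m0) (at 0) \<and>
              antimono_on {-1<..} ((berwald_mean f h)(0 := m0))"
proof -
  define U where "U = interior (epi_L f)"
  obtain c x0 r where cr: "0 < c" "0 < r" "ball x0 r \<subseteq> {x. c < f x}"
    using log_concave_gt_on_ball[OF assms(1,3)] .
  have "x0 \<in> ball x0 r" using cr(2) by simp
  hence "c < f x0" using cr(3) by blast
  also have "\<dots> \<le> sup_norm f"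
    unfolding sup_norm_def using log_concave_integrable_bdd_above[OF assms(1-3)] by (rule cSUP_upper[rotated]) simp
  finally have M: "0 < sup_norm f" using cr by simp
  have conv: "convex (epi_L f)" using assms(1) M by (rule convex_epi_L)
  have U: "open U" "U \<noteq> {}" "U \<subseteq> epi_L f"
    using interior_epi_L_nonempty[OF cr M] interior_subset by (auto simp: U_def)
  have fin: "(\<integral>\<^sup>+z\<in>U. ennreal (exp (- snd z)) \<partial>lborel) < \<infinity>"
    unfolding U_def using log_concave_nonneg[OF assms(1)] assms(2) M by (rule nn_integral_epi_interior_finite)
  have concU: "concave_on U h"
    using convex_on_subset[OF assms(4)[unfolded concave_on_def] U(3)] convex_interior[OF conv]
    unfolding concave_on_def U_def by blast
  have mean: "berwald_mean f h p = epowr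
      ((\<integral>\<^sup>+z\<in>U. epowr (ennreal (h z)) p * ennreal (exp (- snd z)) \<partial>lborel) /
       (ennreal (Gamma (1 + p)) * (\<integral>\<^sup>+z\<in>U. ennreal (exp (- snd z)) \<partial>lborel))) (1 / p)" for p
    unfolding berwald_mean_def U_def by (simp only: set_nn_integral_convex_interior[OF conv])
  have near0: "\<forall>\<^sub>F p in at (0::real). -1 < p \<and> p \<noteq> 0"
    by (intro eventually_conj order_tendstoD(1)[OF tendsto_ident_at] eventually_neq_at_within) simp
  \<comment> \<open>A common format for both cases of \<open>h\<close>: \<open>g\<close> is
    \<open>gamma_mean\<close> if \<open>h\<close> is positive on \<open>U\<close> and constantly 0
    otherwise. Working with \<open>g\<close> avoids the values of \<open>berwald_mean\<close> at 0
    and below -1.\<close>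
  have "\<exists>g m. (g \<longlongrightarrow> m) (at 0) \<and> (\<forall>p>-1. p \<noteq> 0 \<longrightarrow> berwald_mean f h p = g p) \<and>
     (\<forall>p q. -1 < p \<longrightarrow> p < q \<longrightarrow> p \<noteq> 0 \<longrightarrow> q \<noteq> 0 \<longrightarrow> g q \<le> g p)"
  proof (rule concave_on_open_nonneg_cases[OF U(1) concU])
    show "0 \<le> h z" if "z \<in> U" for z using that U assms(5) by blast
  next
    assume "\<And>z. z \<in> U \<Longrightarrow> 0 < h z"
    then interpret concave_on_epigraph U h
      using U fin concU by unfold_locales auto
    obtain m where "(gamma_mean \<longlongrightarrow> m) (at 0)" by (rule gamma_mean_tendsto_0)
    moreover have "berwald_mean f h p = ennreal (gamma_mean p)" if p: "-1 < p" "p \<noteq> 0" for p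
    proof -
      have G: "0 < Gamma (1 + p)" using p by (intro Gamma_real_pos) simp
      have "(\<integral>\<^sup>+z\<in>U. epowr (ennreal (h z)) p * ennreal (exp (- snd z)) \<partial>lborel) =
          (\<integral>\<^sup>+z\<in>U. ennreal (h z powr p) * ennreal (exp (- snd z)) \<partial>lborel)"
      proof (intro nn_integral_cong)
        fix z
        show "epowr (ennreal (h z)) p * ennreal (exp (- snd z)) * indicator U z =
            ennreal (h z powr p) * ennreal (exp (- snd z)) * indicator U z"
          using h_pos[of z] p by (cases "z \<in> U") (auto simp: epowr_def not_le)
      qed
      also have "\<dots> = ennreal (expectation (\<lambda>z. X z powr p) * mass)"
        using p(1) by (rule set_nn_integral_h_powr)
      finally have "berwald_mean f h p =
          epowr (ennreal (expectation (\<lambda>z. X z powr p) * mass) / (ennreal (Gamma (1 + p)) * ennreal mass)) (1 / p)"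
        by (simp only: mean nn_integral_mass)
      also have "ennreal (expectation (\<lambda>z. X z powr p) * mass) / (ennreal (Gamma (1 + p)) * ennreal mass) =
          ennreal (expectation (\<lambda>z. X z powr p) / Gamma (1 + p))"
        using G mass_pos expectation_powr_pos[OF p(1)]
        by (subst ennreal_mult[symmetric]) (auto simp: divide_ennreal less_imp_le)
      also have "epowr \<dots> (1 / p) = ennreal (gamma_mean p)"
      proof -
        have "epowr (ennreal a) b = ennreal (a powr b)" if "0 < a" for a b
          using that by (auto simp: epowr_def not_le)
        thus ?thesis unfolding gamma_mean_def
          using G expectation_powr_pos[OF p(1)] divide_pos_pos by blast
      qed
      finally show ?thesis .
    qed
    ultimately show ?thesis
      using gamma_mean_antimono
      by (intro exI[of _ "\<lambda>p. ennreal (gamma_mean p)"] exI[of _ "ennreal m"])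
        (auto intro!: tendsto_ennrealI ennreal_leI)
  next
    assume h0: "\<And>z. z \<in> U \<Longrightarrow> h z = 0"
    \<comment> \<open>For \<open>p > 0\<close> the integral vanishes and so does its root. For
      \<open>p < 0\<close> the integrand is infinite on a set of positive measure, and
      \<open>epowr\<close> sends infinity to 0 for the negative exponent
      \<open>1 / p\<close>.\<close>
    have "berwald_mean f h p = 0" if p: "-1 < p" "p \<noteq> 0" for p
    proof (cases "p > 0")
      case True
      have "(\<integral>\<^sup>+z\<in>U. epowr (ennreal (h z)) p * ennreal (exp (- snd z)) \<partial>lborel) = (\<integral>\<^sup>+z. 0 \<partial>(lborel :: ((real ^ 'n) \<times> real) measure))"
        using True h0 by (intro nn_integral_cong) (auto simp: epowr_def indicator_def)
      thus ?thesis using True by (simp add: mean epowr_def)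
    next
      case False
      have "(\<integral>\<^sup>+z\<in>U. epowr (ennreal (h z)) p * ennreal (exp (- snd z)) \<partial>lborel) =
          (\<integral>\<^sup>+z. \<infinity> * indicator U z \<partial>lborel)"
        using False p h0 by (intro nn_integral_cong) (auto simp: epowr_def indicator_def ennreal_top_mult)
      also have "\<dots> = \<infinity> * emeasure lborel U"
        using U(1) by (intro nn_integral_cmult_indicator) auto
      also have "emeasure lborel U \<noteq> 0"
      proof
        assume "emeasure lborel U = 0"
        hence "U \<in> null_sets lborel" using U(1) by (auto intro: null_setsI)
        hence "negligible U" by (simp add: negligible_iff_null_sets null_sets_completionI)
        thus False using open_not_negligible[OF U(1,2)] by simp
      qed
      hence "\<infinity> * emeasure lborel U = \<infinity>" by (simp add: ennreal_top_mult)
      finally show ?thesis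
        using False p fin
        by (simp add: mean epowr_def ennreal_top_divide ennreal_mult_eq_top_iff less_top[symmetric])
    qed
    thus ?thesis by (intro exI[of _ "\<lambda>_. 0"] exI[of _ 0]) auto
  qed
  then obtain g m where g: "(g \<longlongrightarrow> m) (at 0)"
      "\<And>p. -1 < p \<Longrightarrow> p \<noteq> 0 \<Longrightarrow> berwald_mean f h p = g p"
      "\<And>p q. -1 < p \<Longrightarrow> p < q \<Longrightarrow> p \<noteq> 0 \<Longrightarrow> q \<noteq> 0 \<Longrightarrow> g q \<le> g p" by blast
  have "\<forall>\<^sub>F p in at 0. g p = berwald_mean f h p"
    using near0 by eventually_elim (simp add: g(2))
  hence "(berwald_mean f h \<longlongrightarrow> m) (at 0)"
    using g(1) by (rule Lim_transform_eventually[rotated])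
  moreover from this have "antimono_on {-1<..} ((berwald_mean f h)(0 := m))"
    by (rule antimono_on_fun_upd_limit) (use g(2,3) in auto)
  ultimately show ?thesis by blast
qed

end
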